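(* For all $n\ge 2$: (1) $\displaystyle \sum_{r\geq 1} \omega\left(h_r[Lie_{\geq 2}]|_{\deg n}\right)=\sum_{k=0}^n (-1)^k p_1^{n-k} h_k = \sum_{r\geq 1} e_r[Lie^{(2)}_{\geq 2}]|_{\deg n}$; (2) $\displaystyle \sum_{r\geq 1} (-1)^{r-1}\omega\left(e_r[Lie_{\geq 2}]|_{\deg n} \right)=s_{(2,1^{n-2})}=\sum_{r\geq 1} (-1)^{r-1}h_r[Lie^{(2)}_{\geq 2}]|_{\deg n}$.
   Context: $h_n,e_n,p_n,s_\lambda$ are the complete homogeneous, elementary, power-sum and Schur functions, $\omega$ is the involution with $\omega(h_n)=e_n$, $f[g]$ is plethysm, and $|_{\deg n}$ denotes the homogeneous component of degree $n$. Let $C_n\subset S_n$ be the cyclic group generated by an $n$-cycle. $Lie_n$ is the Frobenius characteristic of the $S_n$-module induced from the linear character of $C_n$ sending the generator to $\exp(2\pi i/n)$, equivalently $Lie_n=\frac1n\sum_{d|n}\mu(d)p_d^{n/d}$. With $2^{k_n}$ the largest power of $2$ dividing $n$, $Lie_n^{(2)}$ is the Frobenius characteristic of the module induced from the linear character of $C_n$ sending the generator to $\exp(\frac{2\pi i}{n}\cdot 2^{k_n})$. $Lie_{\ge2}=\sum_{n\ge2}Lie_n$ and $Lie^{(2)}_{\ge2}=\sum_{n\ge2}Lie_n^{(2)}$. *)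

theory Defs
  imports
    Complex_Main
    "HOL-Library.Multiset"
    "HOL-Library.FuncSet"
    "HOL-Computational_Algebra.Primes"
    "HOL-Combinatorics.Permutations"
    "HOL-Combinatorics.Orbits"
begin

section \<open>Formal power series in countably many variables\<close>

text \<open>
  Symmetric functions, and infinite sums of symmetric functions of increasing degree, are elements
  of the ring of formal power series in the variables \<open>x\<^sub>0, x\<^sub>1, x\<^sub>2, \<dots>\<close> over the complex numbers.
  A multiset \<open>M\<close> of indices stands for the monomial that is the product of the \<open>x\<^sub>i\<close>, \<open>i \<in># M\<close>, so
  \<open>size M\<close> is its degree and \<open>M + N\<close> the product of two monomials.
\<close>

typedef pser = "UNIV :: (nat multiset \<Rightarrow> complex) set"
  morphisms coeff Abs_pser ..

setup_lifting type_definition_pser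

lemma pser_eqI: "(\<And>M. coeff f M = coeff g M) \<Longrightarrow> f = g"
  by (simp add: coeff_inject[symmetric] fun_eq_iff)

lemma finite_submsets: "finite {A. A \<subseteq># (M :: 'a multiset)}"
proof (induction M)
  case (add x M)
  have "{A. A \<subseteq># add_mset x M} \<subseteq> {A. A \<subseteq># M} \<union> add_mset x ` {A. A \<subseteq># M}"
  proof
    fix A assume A: "A \<in> {A. A \<subseteq># add_mset x M}"
    show "A \<in> {A. A \<subseteq># M} \<union> add_mset x ` {A. A \<subseteq># M}"
    proof (cases "x \<in># A")
      case True
      then obtain B where B: "A = add_mset x B" by (metis insert_DiffM)
      with A show ?thesis by auto
    next
      case False
      have "count A y \<le> count M y" for y
        using mset_subset_eq_count[of A "add_mset x M" y] A False
        by (cases "y = x") (auto simp: not_in_iff)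
      then have "A \<subseteq># M" by (simp add: subseteq_mset_def)
      then show ?thesis by simp
    qed
  qed
  with add show ?case by (meson finite_UnI finite_imageI finite_subset)
qed simp

lemma diff_submset_mono: "B \<subseteq># A \<Longrightarrow> A \<subseteq># M \<Longrightarrow> A - B \<subseteq># M - B"
  for A B M :: "'a multiset"
  by (metis subset_eq_diff_conv subset_mset.diff_add subset_mset.trans)

lemma add_submset: "B \<subseteq># M \<Longrightarrow> C \<subseteq># M - B \<Longrightarrow> B + C \<subseteq># M"
  for B C M :: "'a multiset"
  by (simp add: add.commute subset_mset.le_diff_conv2)

lemma diff_diff_submset: "A \<subseteq># M \<Longrightarrow> M - (M - A) = A"
  for A M :: "'a multiset"
  by (simp add: subset_mset.le_imp_diff_is_add)

instantiation pser :: comm_ring_1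
begin

lift_definition zero_pser :: pser is "\<lambda>M. 0" .
lift_definition one_pser :: pser is "\<lambda>M. if M = {#} then 1 else 0" .
lift_definition plus_pser :: "pser \<Rightarrow> pser \<Rightarrow> pser" is "\<lambda>f g M. f M + g M" .
lift_definition uminus_pser :: "pser \<Rightarrow> pser" is "\<lambda>f M. - f M" .
lift_definition minus_pser :: "pser \<Rightarrow> pser \<Rightarrow> pser" is "\<lambda>f g M. f M - g M" .
lift_definition times_pser :: "pser \<Rightarrow> pser \<Rightarrow> pser" is
  "\<lambda>f g M. \<Sum>A | A \<subseteq># M. f A * g (M - A)" .

instance
proof
  fix a b c :: pser
  show "a * b * c = a * (b * c)"
  proof (transfer, rule ext)
    fix a b c :: "nat multiset \<Rightarrow> complex" and M
    have "(\<Sum>A | A \<subseteq># M. (\<Sum>B | B \<subseteq># A. a B * b (A - B)) * c (M - A))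
        = (\<Sum>(A, B) \<in> (SIGMA A : {A. A \<subseteq># M}. {B. B \<subseteq># A}). a B * b (A - B) * c (M - A))"
      by (simp add: sum_distrib_right sum.Sigma finite_submsets)
    also have "\<dots> = (\<Sum>(B, C) \<in> (SIGMA B : {B. B \<subseteq># M}. {C. C \<subseteq># M - B}).
        a B * (b C * c (M - B - C)))"
      by (rule sum.reindex_bij_witness[where i = "\<lambda>(B, C). (B + C, B)"
            and j = "\<lambda>(A, B). (B, A - B)"])
        (clarsimp simp: mult.assoc diff_submset_mono add_submset,
          (blast intro: subset_mset.trans)?)+
    also have "\<dots> = (\<Sum>B | B \<subseteq># M. a B * (\<Sum>C | C \<subseteq># M - B. b C * c (M - B - C)))"
      by (simp add: sum_distrib_left sum.Sigma finite_submsets)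
    finally show "(\<Sum>A | A \<subseteq># M. (\<Sum>B | B \<subseteq># A. a B * b (A - B)) * c (M - A)) = \<dots>" .
  qed
  show "a * b = b * a"
  proof (transfer, rule ext)
    fix a b :: "nat multiset \<Rightarrow> complex" and M
    show "(\<Sum>A | A \<subseteq># M. a A * b (M - A)) = (\<Sum>A | A \<subseteq># M. b A * a (M - A))"
      by (rule sum.reindex_bij_witness[where i = "\<lambda>A. M - A" and j = "\<lambda>A. M - A"])
        (simp_all add: diff_diff_submset mult.commute)
  qed
  show "1 * a = a"
  proof (transfer, rule ext)
    fix a :: "nat multiset \<Rightarrow> complex" and M
    have "(\<Sum>A | A \<subseteq># M. (if A = {#} then 1 else 0) * a (M - A))
        = (\<Sum>A \<in> {{#}}. (if A = {#} then 1 else 0) * a (M - A))"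
      by (rule sum.mono_neutral_right) (auto simp: finite_submsets)
    then show "(\<Sum>A | A \<subseteq># M. (if A = {#} then 1 else 0) * a (M - A)) = a M" by simp
  qed
  show "(a + b) * c = a * c + b * c"
    by transfer (simp add: distrib_right sum.distrib fun_eq_iff)
  show "a + b + c = a + (b + c)" by transfer (simp add: fun_eq_iff)
  show "a + b = b + a" by transfer (simp add: fun_eq_iff)
  show "0 + a = a" by transfer (simp add: fun_eq_iff)
  show "- a + a = 0" by transfer (simp add: fun_eq_iff)
  show "a - b = a + - b" by transfer (simp add: fun_eq_iff)
  show "(0::pser) \<noteq> 1" by transfer (auto simp: fun_eq_iff)
qed

end

lift_definition const :: "complex \<Rightarrow> pser" is "\<lambda>c M. if M = {#} then c else 0" .

text \<open>The homogeneous component of degree \<open>n\<close>.\<close>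

lift_definition deg_part :: "nat \<Rightarrow> pser \<Rightarrow> pser" is "\<lambda>n f M. if size M = n then f M else 0" .

text \<open>
  Formal sum over a possibly infinite index set. It is meaningful if every monomial occurs in
  only finitely many summands.
\<close>

lift_definition formal_sum :: "nat set \<Rightarrow> (nat \<Rightarrow> pser) \<Rightarrow> pser" is
  "\<lambda>I F M. \<Sum>i | i \<in> I \<and> F i M \<noteq> 0. F i M" .

section \<open>The classical symmetric functions\<close>

lift_definition hsym :: "nat \<Rightarrow> pser" is "\<lambda>n M. if size M = n then 1 else 0" .

lift_definition esym :: "nat \<Rightarrow> pser" is
  "\<lambda>n M. if size M = n \<and> (\<forall>i. count M i \<le> 1) then 1 else 0" .

text \<open>Only used for \<open>n \<ge> 1\<close>.\<close>

lift_definition psym :: "nat \<Rightarrow> pser" is "\<lambda>n M. if \<exists>i. M = replicate_mset n i then 1 else 0" .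

definition young_diagram :: "nat list \<Rightarrow> (nat \<times> nat) set" where
  "young_diagram \<mu> = {(i, j). i < length \<mu> \<and> j < \<mu> ! i}"

definition ssyt :: "nat list \<Rightarrow> (nat \<times> nat \<Rightarrow> nat) set" where
  "ssyt \<mu> = {T \<in> extensional (young_diagram \<mu>).
     (\<forall>i j. (i, Suc j) \<in> young_diagram \<mu> \<longrightarrow> T (i, j) \<le> T (i, Suc j)) \<and>
     (\<forall>i j. (Suc i, j) \<in> young_diagram \<mu> \<longrightarrow> T (i, j) < T (Suc i, j))}"

text \<open>The parts of the partition \<open>\<mu>\<close> are listed in weakly decreasing order.\<close>

lift_definition schur :: "nat list \<Rightarrow> pser" is
  "\<lambda>\<mu> M. of_nat (card {T \<in> ssyt \<mu>. image_mset T (mset_set (young_diagram \<mu>)) = M})" .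

section \<open>The involution and plethysm\<close>

text \<open>
  If \<open>a 1, a 2, \<dots>\<close> are algebraically independent, \<open>alg_ext a b\<close> is the homomorphism of complex
  algebras, defined on the algebra generated by the \<open>a n\<close> (\<open>n \<ge> 1\<close>), that sends \<open>a n\<close> to \<open>b n\<close>:
  it sends a polynomial in the \<open>a n\<close> to the same polynomial in the \<open>b n\<close>. The multisets \<open>\<mu>\<close>
  (of positive integers) are the partitions indexing the monomials of that polynomial.

  The families \<open>hsym\<close> and \<open>psym\<close> are both algebraically independent generators of the algebra of
  symmetric functions, so that \<open>omega\<close> and \<open>\<lambda>f. plethysm f g\<close> are defined on all of it. The second
  argument of \<open>plethysm\<close> need not have bounded degree.
\<close>

definition alg_ext :: "(nat \<Rightarrow> pser) \<Rightarrow> (nat \<Rightarrow> pser) \<Rightarrow> pser \<Rightarrow> pser" where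
  "alg_ext a b f = (THE g. \<exists>P c. finite P \<and> (\<forall>\<mu>\<in>P. 0 \<notin># \<mu>) \<and>
     f = (\<Sum>\<mu>\<in>P. const (c \<mu>) * (\<Prod>i\<in>#\<mu>. a i)) \<and>
     g = (\<Sum>\<mu>\<in>P. const (c \<mu>) * (\<Prod>i\<in>#\<mu>. b i)))"

definition omega :: "pser \<Rightarrow> pser" where
  "omega = alg_ext hsym esym"

text \<open>
  The power series \<open>g(x\<^sub>0\<^sup>k, x\<^sub>1\<^sup>k, \<dots>)\<close>, i.e. the plethysm of the \<open>k\<close>-th power sum with \<open>g\<close>, for \<open>k \<ge> 1\<close>.
\<close>

lift_definition power_subst :: "nat \<Rightarrow> pser \<Rightarrow> pser" is
  "\<lambda>k g M. \<Sum>A | repeat_mset k A = M. g A" .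

definition plethysm :: "pser \<Rightarrow> pser \<Rightarrow> pser" where
  "plethysm f g = alg_ext psym (\<lambda>k. power_subst k g) f"

section \<open>Frobenius characteristic and induction from the cyclic group\<close>

text \<open>The symmetric group acts on \<open>{..<n}\<close>; class functions are functions on permutations.\<close>

definition cycle_type :: "nat \<Rightarrow> (nat \<Rightarrow> nat) \<Rightarrow> nat multiset" where
  "cycle_type n \<sigma> = image_mset card (mset_set (orbit \<sigma> ` {..<n}))"

definition frob_char :: "nat \<Rightarrow> ((nat \<Rightarrow> nat) \<Rightarrow> complex) \<Rightarrow> pser" where
  "frob_char n \<chi> = const (1 / fact n) *
     (\<Sum>\<sigma> | \<sigma> permutes {..<n}. const (\<chi> \<sigma>) * (\<Prod>i\<in>#cycle_type n \<sigma>. psym i))"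

text \<open>The character of the module induced from a module of the subgroup \<open>H\<close> with character \<open>\<psi>\<close>.\<close>

definition induced_char ::
  "nat \<Rightarrow> (nat \<Rightarrow> nat) set \<Rightarrow> ((nat \<Rightarrow> nat) \<Rightarrow> complex) \<Rightarrow> (nat \<Rightarrow> nat) \<Rightarrow> complex" where
  "induced_char n H \<psi> \<sigma> = 1 / of_nat (card H) *
     (\<Sum>\<tau> | \<tau> permutes {..<n} \<and> inv \<tau> \<circ> \<sigma> \<circ> \<tau> \<in> H. \<psi> (inv \<tau> \<circ> \<sigma> \<circ> \<tau>))"

definition long_cycle :: "nat \<Rightarrow> nat \<Rightarrow> nat" where
  "long_cycle n i = (if i < n then Suc i mod n else i)"

definition cyclic_subgroup :: "nat \<Rightarrow> (nat \<Rightarrow> nat) set" where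
  "cyclic_subgroup n = range (\<lambda>k. long_cycle n ^^ k)"

text \<open>
  For \<open>n \<ge> 1\<close> and an \<open>n\<close>-th root of unity \<open>z\<close>, this is the linear character of the cyclic subgroup
  that sends the generator \<open>long_cycle n\<close> to \<open>z\<close>.
\<close>

definition cyclic_char :: "nat \<Rightarrow> complex \<Rightarrow> (nat \<Rightarrow> nat) \<Rightarrow> complex" where
  "cyclic_char n z g = z ^ (LEAST k. long_cycle n ^^ k = g)"

definition Lie :: "nat \<Rightarrow> pser" where
  "Lie n = frob_char n (induced_char n (cyclic_subgroup n)
     (cyclic_char n (exp (2 * of_real pi * \<i> / of_nat n))))"

definition Lie2 :: "nat \<Rightarrow> pser" where
  "Lie2 n = frob_char n (induced_char n (cyclic_subgroup n)
     (cyclic_char n (exp (2 * of_real pi * \<i> / of_nat n * 2 ^ multiplicity (2 :: nat) n))))"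

definition Lie_ge2 :: pser where
  "Lie_ge2 = formal_sum {2..} Lie"

definition Lie2_ge2 :: pser where
  "Lie2_ge2 = formal_sum {2..} Lie2"

end

theory Submission
  imports
    Defs
    "HOL-Library.Multiset_Order"
    "HOL-Number_Theory.Cong"
    "HOL-Analysis.Complex_Transcendental"
begin

text \<open>
  Let \<open>D\<close> be the Euler derivation, which multiplies the component of degree \<open>n\<close> by \<open>n\<close>. For
  \<open>(a, b) = (h, e)\<close> or \<open>(e, h)\<close>, Newton's identities give \<open>D X = X \<cdot> U g\<close> for
  \<open>X = \<Sum>\<^sub>r a\<^sub>r[g]\<close>, where \<open>U g = \<Sum>\<^sub>k \<plusminus> p\<^sub>k[D g]\<close> is additive in \<open>g\<close>. If \<open>g\<close> is the \<open>Lie\<close>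
  (or \<open>Lie\<^sup>(\<^sup>2\<^sup>)\<close>) series without its linear term \<open>p\<^sub>1\<close>, divisor sums of Ramanujan sums show that
  \<open>U g + U p\<^sub>1 = p\<^sub>1 / (1 - p\<^sub>1)\<close>. Hence \<open>D\<close> annihilates \<open>X \<cdot> (\<Sum>\<^sub>r a\<^sub>r) \<cdot> (1 - p\<^sub>1)\<close>, so that this
  product is \<open>1\<close>. Since \<open>\<Sum>\<^sub>r (-1)\<^sup>r b\<^sub>r\<close> is inverse to \<open>\<Sum>\<^sub>r a\<^sub>r\<close>, also after plethysm with \<open>g\<close>,
  both parts of the theorem are read off in degree \<open>n\<close>.
\<close>

section \<open>The ring of power series\<close>

text \<open>\<open>omega\<close> and \<open>plethysm\<close> are given through \<open>THE\<close>,
  as the result of exchanging generators in some polynomial expression, so each use must show that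
  the result does not depend on the expression. This is algebraic independence, proved directly only
  for the \<open>esym n\<close>, whose lowest monomials are easy to name. Newton's recursion carries
  uniqueness over to the power sums, for arbitrary prescribed images, and the duality of e and h
  carries it over to \<open>omega\<close>. Explicit expressions are then avoided:
  \<open>alg_rel\<close> is closed under the ring operations, so identities among generators pass to
  their images.

  A derivation is used because X = exp(sum of signed p_k[g]/k) would require composing power series,
  while D X = X U g requires only products.

  Both Lie series fit one argument because the twist by the 2-part offsets the sign of the
  elementary case: the Ramanujan sums c_d(1) have divisor sums 1, 0, 0, ..., and the twisted ones
  have the same divisor sums once weighted by (-1)^(n/d - 1).\<close>

lemma coeff_0 [simp]: "coeff 0 M = 0"
  and coeff_1: "coeff 1 M = (if M = {#} then 1 else 0)"
  and coeff_add [simp]: "coeff (f + g) M = coeff f M + coeff g M"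
  and coeff_uminus [simp]: "coeff (- f) M = - coeff f M"
  and coeff_diff [simp]: "coeff (f - g) M = coeff f M - coeff g M"
  and coeff_mult: "coeff (f * g) M = (\<Sum>A | A \<subseteq># M. coeff f A * coeff g (M - A))"
  and coeff_const: "coeff (const c) M = (if M = {#} then c else 0)"
  and coeff_deg_part: "coeff (deg_part n f) M = (if size M = n then coeff f M else 0)"
  and coeff_hsym: "coeff (hsym n) M = (if size M = n then 1 else 0)"
  and coeff_esym: "coeff (esym n) M = (if size M = n \<and> (\<forall>i. count M i \<le> 1) then 1 else 0)"
  and coeff_psym: "coeff (psym n) M = (if \<exists>i. M = replicate_mset n i then 1 else 0)"
  and coeff_power_subst: "coeff (power_subst n f) M = (\<Sum>A | repeat_mset n A = M. coeff f A)"
  and coeff_formal_sum: "coeff (formal_sum I F) M = (\<Sum>i | i \<in> I \<and> coeff (F i) M \<noteq> 0. coeff (F i) M)"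
  by (transfer; simp)+

lemma coeff_sum: "coeff (\<Sum>i\<in>I. F i) M = (\<Sum>i\<in>I. coeff (F i) M)"
  by (induction I rule: infinite_finite_induct) auto

lemma coeff_mult_empty: "coeff (f * g) {#} = coeff f {#} * coeff g {#}"
  by (simp add: coeff_mult)

lemma coeff_const_mult [simp]: "coeff (const c * f) M = c * coeff f M"
proof -
  have "coeff (const c * f) M = (\<Sum>A \<in> {{#}}. coeff (const c) A * coeff f (M - A))"
    unfolding coeff_mult
    by (rule sum.mono_neutral_right) (auto simp: finite_submsets coeff_const)
  then show ?thesis by (simp add: coeff_const)
qed

lemma const_0 [simp]: "const 0 = 0"
  and const_1 [simp]: "const 1 = 1"
  and const_add: "const (a + b) = const a + const b"
  and const_uminus: "const (- a) = - const a"
  and const_mult: "const (a * b) = const a * const b"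
  by (auto intro!: pser_eqI simp: coeff_const coeff_1)

lemma const_of_nat: "const (of_nat n) = of_nat n"
  by (induction n) (auto simp: const_add)

lemma const_sum: "const (\<Sum>i\<in>I. F i) = (\<Sum>i\<in>I. const (F i))"
  by (induction I rule: infinite_finite_induct) (auto simp: const_add)

lemma coeff_of_nat_mult [simp]: "coeff (of_nat n * f) M = of_nat n * coeff f M"
  by (metis const_of_nat coeff_const_mult)

lemma coeff_signed_mult [simp]: "coeff ((-1) ^ n * f) M = (-1) ^ n * coeff f M"
  by (induction n) (simp_all add: mult.assoc)

lemma of_nat_mult_cancel_pser:
  assumes "of_nat n * f = of_nat n * g" "n \<noteq> 0"
  shows "f = (g :: pser)"
proof (rule pser_eqI)
  fix M
  from assms(1) have "of_nat n * coeff f M = of_nat n * coeff g M"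
    by (metis coeff_of_nat_mult)
  with assms(2) show "coeff f M = coeff g M" by simp
qed

lemma deg_part_0 [simp]: "deg_part n 0 = 0"
  and deg_part_add: "deg_part n (f + g) = deg_part n f + deg_part n g"
  and deg_part_uminus: "deg_part n (- f) = - deg_part n f"
  and deg_part_diff: "deg_part n (f - g) = deg_part n f - deg_part n g"
  by (auto intro!: pser_eqI simp: coeff_deg_part)

lemma deg_part_signed: "deg_part n ((-1) ^ k * f) = (-1) ^ k * deg_part n f"
  by (auto intro!: pser_eqI simp: coeff_deg_part)

lemma deg_part_mult: "deg_part n (f * g) = (\<Sum>i\<le>n. deg_part i f * deg_part (n - i) g)"
proof (rule pser_eqI)
  fix M
  have "coeff (\<Sum>i\<le>n. deg_part i f * deg_part (n - i) g) M =
      (\<Sum>A | A \<subseteq># M. \<Sum>i\<le>n. coeff (deg_part i f) A * coeff (deg_part (n - i) g) (M - A))"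
    unfolding coeff_sum coeff_mult by (rule sum.swap)
  also have "\<dots> = (\<Sum>A | A \<subseteq># M. if size M = n then coeff f A * coeff g (M - A) else 0)"
  proof (rule sum.cong[OF refl])
    fix A assume "A \<in> {A. A \<subseteq># M}"
    then have A: "size (M - A) = size M - size A" "size A \<le> size M"
      by (auto simp: size_Diff_submset size_mset_mono)
    \<comment> \<open>Only \<open>i = size A\<close> survives, and then
      \<open>size (M - A) = n - i\<close> amounts to \<open>size M = n\<close>.\<close>
    have "(\<Sum>i\<le>n. coeff (deg_part i f) A * coeff (deg_part (n - i) g) (M - A)) =
        (\<Sum>i\<le>n. if i = size A then (if size M = n then coeff f A * coeff g (M - A) else 0) else 0)"
      using A by (intro sum.cong) (auto simp: coeff_deg_part)
    with A show "(\<Sum>i\<le>n. coeff (deg_part i f) A * coeff (deg_part (n - i) g) (M - A)) =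
        (if size M = n then coeff f A * coeff g (M - A) else 0)"
      by auto
  qed
  also have "\<dots> = coeff (deg_part n (f * g)) M"
    by (simp add: coeff_deg_part coeff_mult)
  finally show "coeff (deg_part n (f * g)) M = coeff (\<Sum>i\<le>n. deg_part i f * deg_part (n - i) g) M" ..
qed

text \<open>An implication on nonzero coefficients, so that 0 is homogeneous of every
  degree.\<close>

definition homogeneous :: "nat \<Rightarrow> pser \<Rightarrow> bool" where
  "homogeneous n f \<longleftrightarrow> (\<forall>M. coeff f M \<noteq> 0 \<longrightarrow> size M = n)"

lemma homogeneous_sym:
  "homogeneous n (hsym n)" "homogeneous n (esym n)" "homogeneous n (psym n)"
  by (auto simp: homogeneous_def coeff_hsym coeff_esym coeff_psym)

lemma homogeneous_deg_part: "homogeneous n f \<Longrightarrow> deg_part m f = (if m = n then f else 0)"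
  by (auto intro!: pser_eqI simp: coeff_deg_part homogeneous_def)

lemma homogeneous_mult:
  assumes "homogeneous m f" "homogeneous n g"
  shows "homogeneous (m + n) (f * g)"
  unfolding homogeneous_def
proof (intro allI impI)
  fix M assume "coeff (f * g) M \<noteq> 0"
  then obtain A where A: "A \<subseteq># M" "coeff f A \<noteq> 0" "coeff g (M - A) \<noteq> 0"
    unfolding coeff_mult by (metis (mono_tags, lifting) mem_Collect_eq mult_eq_0_iff sum.neutral)
  with assms have "size A = m" "size (M - A) = n" by (auto simp: homogeneous_def)
  with A(1) show "size M = m + n"
    by (metis size_union subset_mset.add_diff_inverse)
qed

lemma homogeneous_sum:
  assumes "\<And>i. i \<in> I \<Longrightarrow> homogeneous n (F i)"
  shows "homogeneous n (\<Sum>i\<in>I. F i)"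
  unfolding homogeneous_def
proof (intro allI impI)
  fix M assume "coeff (\<Sum>i\<in>I. F i) M \<noteq> 0"
  then obtain i where "i \<in> I" "coeff (F i) M \<noteq> 0"
    unfolding coeff_sum by (meson sum.not_neutral_contains_not_neutral)
  with assms show "size M = n" by (auto simp: homogeneous_def)
qed

lemma homogeneous_1: "homogeneous 0 1"
  by (simp add: homogeneous_def coeff_1)

lemma homogeneous_power: "homogeneous n f \<Longrightarrow> homogeneous (n * k) (f ^ k)"
  by (induction k) (auto simp: homogeneous_1 intro: homogeneous_mult)

subsection \<open>Order of vanishing and convergent sums\<close>

text \<open>The convergence criterion: if each \<open>F r\<close> vanishes below \<open>r\<close>, a
  monomial of degree s meets only \<open>F 0\<close>, ..., \<open>F s\<close>, so the formal sum is
  meaningful.\<close>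

definition vanish_below :: "nat \<Rightarrow> pser \<Rightarrow> bool" where
  "vanish_below n f \<longleftrightarrow> (\<forall>M. size M < n \<longrightarrow> coeff f M = 0)"

lemma vanish_below_0 [simp]: "vanish_below 0 f"
  by (simp add: vanish_below_def)

lemma homogeneous_vanish_below: "homogeneous n f \<Longrightarrow> vanish_below n f"
  by (auto simp: vanish_below_def homogeneous_def)

lemma vanish_below_sum: "(\<And>i. i \<in> I \<Longrightarrow> vanish_below n (F i)) \<Longrightarrow> vanish_below n (\<Sum>i\<in>I. F i)"
  by (auto simp: vanish_below_def coeff_sum)

lemma vanish_below_signed: "vanish_below n f \<Longrightarrow> vanish_below n ((-1) ^ k * f)"
  by (auto simp: vanish_below_def)

lemma vanish_below_mult:
  assumes "vanish_below m f" "vanish_below n g"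
  shows "vanish_below (m + n) (f * g)"
  unfolding vanish_below_def
proof (intro allI impI)
  fix M :: "nat multiset" assume M: "size M < m + n"
  show "coeff (f * g) M = 0"
    unfolding coeff_mult
  proof (rule sum.neutral, safe)
    fix A assume "A \<subseteq># M"
    then have "size A + size (M - A) = size M"
      by (metis size_union subset_mset.add_diff_inverse)
    with M have "size A < m \<or> size (M - A) < n" by linarith
    with assms show "coeff f A * coeff g (M - A) = 0" by (auto simp: vanish_below_def)
  qed
qed

abbreviation series :: "(nat \<Rightarrow> pser) \<Rightarrow> pser" where
  "series \<equiv> formal_sum UNIV"

text \<open>Any bound \<open>N \<ge> size M\<close> is allowed, so that in a product one bound
  serves all submultisets of a monomial at once.\<close>

lemma coeff_series:
  assumes "\<And>r. vanish_below r (F r)" "size M \<le> N"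
  shows "coeff (series F) M = (\<Sum>r\<le>N. coeff (F r) M)"
proof -
  have "{i. coeff (F i) M \<noteq> 0} \<subseteq> {..N}"
    using assms by (auto simp: vanish_below_def) (meson le_trans not_le)
  then show ?thesis
    unfolding coeff_formal_sum by (intro sum.mono_neutral_left) auto
qed

lemma deg_part_series:
  assumes "\<And>r. vanish_below r (F r)"
  shows "deg_part n (series F) = (\<Sum>r\<le>n. deg_part n (F r))"
  by (rule pser_eqI) (auto simp: coeff_deg_part coeff_sum coeff_series[OF assms])

lemma series_mult:
  assumes F: "\<And>r. vanish_below r (F r)" and G: "\<And>r. vanish_below r (G r)"
  shows "series F * series G = series (\<lambda>n. \<Sum>i\<le>n. F i * G (n - i))"
proof (rule pser_eqI)
  fix M :: "nat multiset"
  let ?N = "size M"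
  have FG: "vanish_below (i + j) (F i * G j)" for i j
    by (intro vanish_below_mult F G)
  have conv: "vanish_below n (\<Sum>i\<le>n. F i * G (n - i))" for n
    by (rule vanish_below_sum) (metis FG atMost_iff le_add_diff_inverse)
  have "coeff (series F * series G) M =
      (\<Sum>A | A \<subseteq># M. (\<Sum>i\<le>?N. coeff (F i) A) * (\<Sum>j\<le>?N. coeff (G j) (M - A)))"
    unfolding coeff_mult
    by (intro sum.cong refl arg_cong2[of _ _ _ _ "(*)"] coeff_series F G)
      (auto simp: size_mset_mono)
  also have "\<dots> = (\<Sum>A | A \<subseteq># M. \<Sum>i\<le>?N. \<Sum>j\<le>?N. coeff (F i) A * coeff (G j) (M - A))"
    by (simp add: sum_product)
  also have "\<dots> = (\<Sum>i\<le>?N. \<Sum>j\<le>?N. coeff (F i * G j) M)"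
    unfolding coeff_mult by (subst sum.swap, rule sum.cong[OF refl], rule sum.swap)
  also have "\<dots> = (\<Sum>(i, j) \<in> {..?N} \<times> {..?N}. coeff (F i * G j) M)"
    by (simp add: sum.cartesian_product)
  \<comment> \<open>\<open>F i * G j\<close> vanishes below \<open>i + j\<close>, so the part of the
    square beyond the diagonal contributes nothing.\<close>
  also have "\<dots> = (\<Sum>(i, j) \<in> {(i, j). i + j \<le> ?N}. coeff (F i * G j) M)"
    by (rule sum.mono_neutral_right) (use FG in \<open>auto simp: vanish_below_def not_le intro: leI\<close>)
  also have "\<dots> = (\<Sum>n\<le>?N. \<Sum>i\<le>n. coeff (F i * G (n - i)) M)"
    by (rule sum.triangle_reindex_eq)
  also have "\<dots> = coeff (series (\<lambda>n. \<Sum>i\<le>n. F i * G (n - i))) M"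
    by (simp add: coeff_series[OF conv order_refl] coeff_sum)
  finally show "coeff (series F * series G) M = \<dots>" .
qed

lemma series_cong: "(\<And>r. F r = G r) \<Longrightarrow> series F = series G"
  by presburger

lemma series_singleton: "series (\<lambda>n. if n = 0 then f else 0) = f"
proof (rule pser_eqI)
  fix M
  have "{i. coeff (if i = (0::nat) then f else 0) M \<noteq> 0} = (if coeff f M = 0 then {} else {0})"
    by auto
  then show "coeff (series (\<lambda>n. if n = 0 then f else 0)) M = coeff f M"
    by (simp add: coeff_formal_sum)
qed

lemma formal_sum_eq_sum:
  assumes "\<And>r. r \<in> I \<Longrightarrow> r \<notin> J \<Longrightarrow> F r = 0" "finite J" "J \<subseteq> I"
  shows "formal_sum I F = (\<Sum>r\<in>J. F r)"
proof (rule pser_eqI)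
  fix M
  have "r \<in> J" if "r \<in> I" "coeff (F r) M \<noteq> 0" for r
    by (rule ccontr) (use that assms(1)[of r] in simp)
  then have "{i \<in> I. coeff (F i) M \<noteq> 0} \<subseteq> J" by blast
  with assms show "coeff (formal_sum I F) M = coeff (\<Sum>r\<in>J. F r) M"
    unfolding coeff_formal_sum coeff_sum by (intro sum.mono_neutral_left) auto
qed

subsection \<open>The Euler derivation\<close>

lift_definition euler :: "pser \<Rightarrow> pser" is "\<lambda>f M. of_nat (size M) * f M" .

lemma coeff_euler: "coeff (euler f) M = of_nat (size M) * coeff f M"
  by transfer simp

lemma euler_mult: "euler (f * g) = euler f * g + f * euler g"
proof (rule pser_eqI)
  fix M
  have "of_nat (size M) * (coeff f A * coeff g (M - A)) =
      of_nat (size A) * coeff f A * coeff g (M - A)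
      + coeff f A * (of_nat (size (M - A)) * coeff g (M - A))" if "A \<subseteq># M" for A
  proof -
    have "size M = size A + size (M - A)"
      using that by (metis size_union subset_mset.add_diff_inverse)
    then show ?thesis by (simp add: algebra_simps)
  qed
  then show "coeff (euler (f * g)) M = coeff (euler f * g + f * euler g) M"
    by (simp add: coeff_euler coeff_mult sum_distrib_left flip: sum.distrib)
qed

lemma euler_add: "euler (f + g) = euler f + euler g"
  and euler_diff: "euler (f - g) = euler f - euler g"
  and euler_0 [simp]: "euler 0 = 0"
  and euler_1 [simp]: "euler 1 = 0"
  by (auto intro!: pser_eqI simp: coeff_euler coeff_1 algebra_simps)

lemma euler_of_nat_mult: "euler (of_nat n * f) = of_nat n * euler f"
  and euler_signed: "euler ((-1) ^ k * f) = (-1) ^ k * euler f"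
  by (auto intro!: pser_eqI simp: coeff_euler)

lemma euler_sum: "euler (\<Sum>i\<in>I. F i) = (\<Sum>i\<in>I. euler (F i))"
  by (induction I rule: infinite_finite_induct) (auto simp: euler_add)

lemma euler_homogeneous: "homogeneous n f \<Longrightarrow> euler f = of_nat n * f"
  by (auto intro!: pser_eqI simp: coeff_euler homogeneous_def)

lemma vanish_below_euler: "vanish_below n f \<Longrightarrow> vanish_below n (euler f)"
  by (simp add: vanish_below_def coeff_euler)

lemma euler_series:
  assumes "\<And>r. vanish_below r (F r)"
  shows "euler (series F) = series (\<lambda>r. euler (F r))"
  by (rule pser_eqI)
    (simp add: coeff_euler coeff_series[OF assms order_refl] sum_distrib_left
      coeff_series[OF vanish_below_euler[OF assms] order_refl])

text \<open>Characteristic zero: a positive degree can be cancelled. This takes the place of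
  integrating a logarithmic derivative.\<close>

lemma euler_eq_0_imp_const:
  assumes "euler f = 0"
  shows "f = const (coeff f {#})"
proof (rule pser_eqI)
  fix M
  have "of_nat (size M) * coeff f M = 0"
    by (metis assms coeff_0 coeff_euler)
  then show "coeff f M = coeff (const (coeff f {#})) M"
    by (auto simp: coeff_const)
qed

subsection \<open>Substitution of powers\<close>

lemma repeat_mset_inj: "k \<ge> 1 \<Longrightarrow> repeat_mset k A = repeat_mset k B \<longleftrightarrow> A = B"
  by (auto simp: multiset_eq_iff)

lemma coeff_power_subst_repeat:
  assumes "k \<ge> 1"
  shows "coeff (power_subst k f) (repeat_mset k A) = coeff f A"
  using assms by (simp add: coeff_power_subst repeat_mset_inj)

lemma coeff_power_subst_eq_0:
  assumes "\<And>A. M \<noteq> repeat_mset k A"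
  shows "coeff (power_subst k f) M = 0"
proof -
  have "{A. repeat_mset k A = M} = {}" using assms by blast
  then show ?thesis by (simp add: coeff_power_subst)
qed

text \<open>For \<open>k \<ge> 1\<close> the map \<open>repeat_mset k\<close> is injective, so the
  sum defining \<open>power_subst\<close> has at most one term, and coefficients are compared on the
  image of this map and off it.\<close>

lemma power_subst_eqI:
  assumes "k \<ge> 1" "\<And>A. coeff g (repeat_mset k A) = coeff f A"
    and "\<And>M. (\<And>A. M \<noteq> repeat_mset k A) \<Longrightarrow> coeff g M = 0"
  shows "power_subst k f = g"
  by (rule pser_eqI) (metis assms coeff_power_subst_eq_0 coeff_power_subst_repeat)

lemma power_subst_0 [simp]: "power_subst k 0 = 0"
  and power_subst_add: "power_subst k (f + g) = power_subst k f + power_subst k g"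
  and power_subst_const_mult: "power_subst k (const c * f) = const c * power_subst k f"
  by (auto intro!: pser_eqI simp: coeff_power_subst sum.distrib sum_distrib_left)

lemma power_subst_sum: "power_subst k (\<Sum>i\<in>I. F i) = (\<Sum>i\<in>I. power_subst k (F i))"
  by (induction I rule: infinite_finite_induct) (auto simp: power_subst_add)

lemma power_subst_const: 
  assumes "k \<ge> 1"
  shows "power_subst k (const c) = const c"
proof (rule power_subst_eqI[OF assms])
  show "coeff (const c) (repeat_mset k A) = coeff (const c) A" for A
    using repeat_mset_inj[OF assms, of A "{#}"] by (simp add: coeff_const)
  show "coeff (const c) M = 0" if "\<And>A. M \<noteq> repeat_mset k A" for M
    using that[of "{#}"] by (auto simp: coeff_const)
qed

lemma subset_repeat_mset:
  assumes "k \<ge> 1" "repeat_mset k A + B = repeat_mset k M"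
  shows "\<exists>C. B = repeat_mset k C \<and> M = A + C"
proof (intro exI conjI)
  have count: "k * count A x + count B x = k * count M x" for x
    using assms(2) by (metis count_repeat_mset count_union)
  have "A \<subseteq># M"
    using assms(1) count by (metis le_add1 mult_le_cancel1 One_nat_def Suc_le_eq subseteq_mset_def)
  then show "M = A + (M - A)" by simp
  show "B = repeat_mset k (M - A)"
  proof (rule multiset_eqI)
    fix x show "count B x = count (repeat_mset k (M - A)) x"
      using count[of x] by (simp add: diff_mult_distrib2)
  qed
qed

text \<open>In the convolution at a \<open>k\<close>-fold multiple, submultisets that are not
  \<open>k\<close>-fold multiples contribute 0. At any other monomial, a nonzero term would write it
  as a sum of two \<open>k\<close>-fold multiples.\<close>

lemma power_subst_mult:
  assumes k: "k \<ge> 1"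
  shows "power_subst k (f * g) = power_subst k f * power_subst k g"
proof (rule power_subst_eqI[OF k])
  fix M
  have "coeff (power_subst k f * power_subst k g) (repeat_mset k M) =
      (\<Sum>A \<in> repeat_mset k ` {A. A \<subseteq># M}.
        coeff (power_subst k f) A * coeff (power_subst k g) (repeat_mset k M - A))"
    unfolding coeff_mult
  proof (rule sum.mono_neutral_right)
    show "repeat_mset k ` {A. A \<subseteq># M} \<subseteq> {A. A \<subseteq># repeat_mset k M}"
      by (auto simp: subseteq_mset_def)
    show "\<forall>A\<in>{A. A \<subseteq># repeat_mset k M} - repeat_mset k ` {A. A \<subseteq># M}.
       coeff (power_subst k f) A * coeff (power_subst k g) (repeat_mset k M - A) = 0"
    proof
      fix A assume A: "A \<in> {A. A \<subseteq># repeat_mset k M} - repeat_mset k ` {A. A \<subseteq># M}"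
      show "coeff (power_subst k f) A * coeff (power_subst k g) (repeat_mset k M - A) = 0"
      proof (cases "\<exists>B. A = repeat_mset k B")
        case True
        then obtain B where B: "A = repeat_mset k B" by blast
        with A have "repeat_mset k B + (repeat_mset k M - A) = repeat_mset k M"
          by auto
        from subset_repeat_mset[OF k this] have "B \<subseteq># M" by auto
        with A B show ?thesis by blast
      next
        case False
        then show ?thesis by (simp add: coeff_power_subst_eq_0)
      qed
    qed
  qed (rule finite_submsets)
  also have "\<dots> = (\<Sum>A | A \<subseteq># M. coeff f A * coeff g (M - A))"
  proof (subst sum.reindex)
    show "inj_on (repeat_mset k) {A. A \<subseteq># M}"
      using repeat_mset_inj[OF k] by (auto simp: inj_on_def)
    have *: "repeat_mset k M - repeat_mset k A = repeat_mset k (M - A)" for A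
      by (simp add: multiset_eq_iff diff_mult_distrib2)
    show "sum ((\<lambda>A. coeff (power_subst k f) A * coeff (power_subst k g) (repeat_mset k M - A))
         \<circ> repeat_mset k) {A. A \<subseteq># M} = (\<Sum>A | A \<subseteq># M. coeff f A * coeff g (M - A))"
      by (rule sum.cong) (simp_all add: coeff_power_subst_repeat[OF k] *)
  qed
  finally show "coeff (power_subst k f * power_subst k g) (repeat_mset k M) = coeff (f * g) M"
    by (simp add: coeff_mult)
next
  fix M :: "nat multiset" assume M: "\<And>A. M \<noteq> repeat_mset k A"
  show "coeff (power_subst k f * power_subst k g) M = 0"
    unfolding coeff_mult
  proof (rule sum.neutral, safe, rule ccontr)
    fix A assume A: "A \<subseteq># M"
      and nz: "coeff (power_subst k f) A * coeff (power_subst k g) (M - A) \<noteq> 0"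
    from nz obtain B C where "A = repeat_mset k B" "M - A = repeat_mset k C"
      by (metis coeff_power_subst_eq_0 mult_zero_left mult_zero_right)
    with A have "M = repeat_mset k (B + C)"
      by (metis repeat_mset_distrib2 subset_mset.add_diff_inverse)
    with M show False by blast
  qed
qed

lemma power_subst_power: "k \<ge> 1 \<Longrightarrow> power_subst k (f ^ n) = power_subst k f ^ n"
  by (induction n) (auto simp: power_subst_mult power_subst_const[of k 1, simplified])

lemma power_subst_psym:
  assumes k: "k \<ge> 1"
  shows "power_subst k (psym j) = psym (k * j)"
proof (rule power_subst_eqI[OF k])
  have *: "repeat_mset k (replicate_mset j i) = replicate_mset (k * j) i" for i :: nat
    by (simp add: multiset_eq_iff)
  show "coeff (psym (k * j)) (repeat_mset k A) = coeff (psym j) A" for A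
    unfolding coeff_psym *[symmetric] repeat_mset_inj[OF k] ..
  show "coeff (psym (k * j)) M = 0" if "\<And>A. M \<noteq> repeat_mset k A" for M
    using that unfolding coeff_psym by (simp flip: *)
qed

lemma size_repeat_mset: "size (repeat_mset k A) = k * size A"
  by (induction k) auto

lemma vanish_below_power_subst:
  assumes k: "k \<ge> 1" and "vanish_below n f"
  shows "vanish_below (k * n) (power_subst k f)"
  unfolding vanish_below_def
proof (intro allI impI)
  fix M :: "nat multiset" assume M: "size M < k * n"
  show "coeff (power_subst k f) M = 0"
  proof (cases "\<exists>A. M = repeat_mset k A")
    case True
    with M k assms(2) show ?thesis
      by (auto simp: coeff_power_subst_repeat size_repeat_mset vanish_below_def)
  next
    case False
    then show ?thesis by (simp add: coeff_power_subst_eq_0)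
  qed
qed

lemma deg_part_power_subst:
  assumes k: "k \<ge> 1"
  shows "deg_part n (power_subst k f) = (if k dvd n then power_subst k (deg_part (n div k) f) else 0)"
proof (rule pser_eqI)
  fix M
  show "coeff (deg_part n (power_subst k f)) M =
      coeff (if k dvd n then power_subst k (deg_part (n div k) f) else 0) M"
  proof (cases "\<exists>A. M = repeat_mset k A")
    case True
    with k show ?thesis
      by (auto simp: coeff_power_subst_repeat coeff_deg_part size_repeat_mset)
  next
    case False
    then show ?thesis by (simp add: coeff_power_subst_eq_0 coeff_deg_part)
  qed
qed

text \<open>Chain rule for raising the variables to the power \<open>k\<close>. The factor
  \<open>k\<close> cancels the denominator of p_k/k in the logarithm of a generating function;
  \<open>euler_newton\<close> relies on it.\<close>

lemma euler_power_subst: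
  assumes k: "k \<ge> 1"
  shows "euler (power_subst k f) = of_nat k * power_subst k (euler f)"
proof (rule pser_eqI)
  fix M
  show "coeff (euler (power_subst k f)) M = coeff (of_nat k * power_subst k (euler f)) M"
  proof (cases "\<exists>A. M = repeat_mset k A")
    case True
    with k show ?thesis
      by (auto simp: coeff_power_subst_repeat coeff_euler size_repeat_mset)
  next
    case False
    then show ?thesis by (simp add: coeff_power_subst_eq_0 coeff_euler)
  qed
qed

section \<open>Homomorphisms between algebras generated by sequences\<close>

text \<open>The graph of \<open>alg_ext a b\<close>, provided that this relation is functional.\<close>

inductive alg_rel :: "(nat \<Rightarrow> pser) \<Rightarrow> (nat \<Rightarrow> pser) \<Rightarrow> pser \<Rightarrow> pser \<Rightarrow> bool" for a b where
  alg_rel_const: "alg_rel a b (const c) (const c)"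
| alg_rel_gen: "n \<ge> 1 \<Longrightarrow> alg_rel a b (a n) (b n)"
| alg_rel_add: "alg_rel a b f g \<Longrightarrow> alg_rel a b f' g' \<Longrightarrow> alg_rel a b (f + f') (g + g')"
| alg_rel_mult: "alg_rel a b f g \<Longrightarrow> alg_rel a b f' g' \<Longrightarrow> alg_rel a b (f * f') (g * g')"

lemma alg_rel_0: "alg_rel a b 0 0"
  using alg_rel_const[of a b 0] by simp

lemma alg_rel_1: "alg_rel a b 1 1"
  using alg_rel_const[of a b 1] by simp

lemma alg_rel_signed:
  assumes "alg_rel a b f g"
  shows "alg_rel a b ((-1) ^ k * f) ((-1) ^ k * g)"
proof -
  have "alg_rel a b (const ((-1) ^ k) * f) (const ((-1) ^ k) * g)"
    by (intro alg_rel_mult alg_rel_const assms)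
  moreover have "const ((-1) ^ k) = (-1) ^ k"
    by (induction k) (simp_all add: const_uminus)
  ultimately show ?thesis by simp
qed

lemma alg_rel_diff:
  assumes "alg_rel a b f g" "alg_rel a b f' g'"
  shows "alg_rel a b (f - f') (g - g')"
  using alg_rel_add[OF assms(1) alg_rel_signed[OF assms(2), of 1]] by simp

lemma alg_rel_power: "alg_rel a b f g \<Longrightarrow> alg_rel a b (f ^ k) (g ^ k)"
  by (induction k) (auto simp: alg_rel_1 intro: alg_rel_mult)

lemma alg_rel_sum:
  "(\<And>i. i \<in> I \<Longrightarrow> alg_rel a b (F i) (G i)) \<Longrightarrow> alg_rel a b (\<Sum>i\<in>I. F i) (\<Sum>i\<in>I. G i)"
  by (induction I rule: infinite_finite_induct) (auto simp: alg_rel_0 intro: alg_rel_add)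

text \<open>Change of generators: it suffices to express the old generators and their images through
  the new ones.\<close>

lemma alg_rel_trans:
  assumes "alg_rel a b f g" "\<And>n. n \<ge> 1 \<Longrightarrow> alg_rel a' b' (a n) (b n)"
  shows "alg_rel a' b' f g"
  using assms(1) by induction (auto intro: alg_rel.intros assms(2))

text \<open>Which series are polynomials in the \<open>a n\<close> does not depend on the images
  prescribed for the \<open>a n\<close>.\<close>

lemma alg_rel_change_target:
  assumes "alg_rel a b f g"
  shows "\<exists>g'. alg_rel a b' f g'"
  using assms by induction (blast intro: alg_rel.intros)+

definition represents ::
  "(nat \<Rightarrow> pser) \<Rightarrow> nat multiset set \<Rightarrow> (nat multiset \<Rightarrow> complex) \<Rightarrow> pser \<Rightarrow> bool" where
  "represents a P c f \<longleftrightarrow> f = (\<Sum>\<mu>\<in>P. const (c \<mu>) * (\<Prod>i\<in>#\<mu>. a i))"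

text \<open>Collects like terms: the family may list a monomial several times, as sums and products
  of polynomials do, whereas \<open>alg_ext\<close> attaches coefficients to a set of
  monomials.\<close>

lemma represents_family:
  fixes m :: "'i \<Rightarrow> nat multiset"
  assumes "finite I"
  shows "represents a (m ` I) (\<lambda>\<mu>. \<Sum>i | i \<in> I \<and> m i = \<mu>. c i)
      (\<Sum>i\<in>I. const (c i) * (\<Prod>j\<in>#m i. a j))"
proof -
  have "(\<Sum>i\<in>I. const (c i) * (\<Prod>j\<in>#m i. a j)) =
      (\<Sum>\<mu>\<in>m ` I. \<Sum>i | i \<in> I \<and> m i = \<mu>. const (c i) * (\<Prod>j\<in>#m i. a j))"
    by (rule sum.image_gen[OF assms])
  also have "\<dots> = (\<Sum>\<mu>\<in>m ` I. const (\<Sum>i | i \<in> I \<and> m i = \<mu>. c i) * (\<Prod>j\<in>#\<mu>. a j))"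
    by (rule sum.cong[OF refl]) (auto simp: const_sum sum_distrib_right intro: sum.cong)
  finally show ?thesis unfolding represents_def .
qed

text \<open>The collected coefficients depend on \<open>m\<close> and \<open>c\<close> but not on
  the generators, so the same polynomial represents \<open>f\<close> and \<open>g\<close>.\<close>

lemma represented_family:
  fixes m :: "'i \<Rightarrow> nat multiset"
  assumes "finite I" "\<And>i. i \<in> I \<Longrightarrow> 0 \<notin># m i"
    and "f = (\<Sum>i\<in>I. const (c i) * (\<Prod>j\<in>#m i. a j))"
    and "g = (\<Sum>i\<in>I. const (c i) * (\<Prod>j\<in>#m i. b j))"
  shows "\<exists>P c. finite P \<and> (\<forall>\<mu>\<in>P. 0 \<notin># \<mu>) \<and> represents a P c f \<and> represents b P c g"
  using assms represents_family[OF assms(1)]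
  by (intro exI[of _ "m ` I"] exI[of _ "\<lambda>\<mu>. \<Sum>i | i \<in> I \<and> m i = \<mu>. c i"]) auto

lemma alg_rel_prod_mset:
  "0 \<notin># \<mu> \<Longrightarrow> alg_rel a b (\<Prod>i\<in>#\<mu>. a i) (\<Prod>i\<in>#\<mu>. b i)"
proof (induction \<mu>)
  case (add i \<mu>)
  then show ?case
    by (auto simp: Suc_le_eq intro!: alg_rel_mult alg_rel_gen)
qed (auto intro: alg_rel_1)

lemma alg_rel_iff:
  "alg_rel a b f g \<longleftrightarrow>
    (\<exists>P c. finite P \<and> (\<forall>\<mu>\<in>P. 0 \<notin># \<mu>) \<and> represents a P c f \<and> represents b P c g)"
proof
  assume "alg_rel a b f g"
  then show "\<exists>P c. finite P \<and> (\<forall>\<mu>\<in>P. 0 \<notin># \<mu>) \<and> represents a P c f \<and> represents b P c g"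
  proof induction
    case (alg_rel_const c)
    show ?case
      by (rule represented_family[where I = "{()}" and m = "\<lambda>_. {#}" and c = "\<lambda>_. c"]) auto
  next
    case (alg_rel_gen n)
    then show ?case
      by (intro represented_family[where I = "{()}" and m = "\<lambda>_. {#n#}" and c = "\<lambda>_. 1"]) auto
  next
    case (alg_rel_add f g f' g')
    then obtain P c P' c' where P: "finite P" "\<forall>\<mu>\<in>P. 0 \<notin># \<mu>" "represents a P c f" "represents b P c g"
      and P': "finite P'" "\<forall>\<mu>\<in>P'. 0 \<notin># \<mu>" "represents a P' c' f'" "represents b P' c' g'"
      by blast
    from P P' show ?case
      \<comment> \<open>A disjoint union, since a monomial may occur in both polynomials.\<close>
      by (intro represented_family[where I = "P <+> P'" and m = "case_sum id id"
            and c = "case_sum c c'"])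
        (auto simp: represents_def sum.Plus)
  next
    case (alg_rel_mult f g f' g')
    then obtain P c P' c' where P: "finite P" "\<forall>\<mu>\<in>P. 0 \<notin># \<mu>" "represents a P c f" "represents b P c g"
      and P': "finite P'" "\<forall>\<mu>\<in>P'. 0 \<notin># \<mu>" "represents a P' c' f'" "represents b P' c' g'"
      by blast
    have *: "(\<Sum>\<mu>\<in>P. const (c \<mu>) * (\<Prod>i\<in>#\<mu>. d i)) * (\<Sum>\<mu>\<in>P'. const (c' \<mu>) * (\<Prod>i\<in>#\<mu>. d i)) =
        (\<Sum>i\<in>P \<times> P'. const (case i of (\<mu>, \<nu>) \<Rightarrow> c \<mu> * c' \<nu>) *
          (\<Prod>j\<in>#(case i of (\<mu>, \<nu>) \<Rightarrow> \<mu> + \<nu>). d j))" for d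
      unfolding sum_product sum.cartesian_product
      by (rule sum.cong) (auto simp: const_mult mult_ac)
    from P P' show ?case
      by (intro represented_family[where I = "P \<times> P'" and m = "\<lambda>(\<mu>, \<nu>). \<mu> + \<nu>"
            and c = "\<lambda>(\<mu>, \<nu>). c \<mu> * c' \<nu>"])
        (auto simp: represents_def *)
  qed
next
  assume "\<exists>P c. finite P \<and> (\<forall>\<mu>\<in>P. 0 \<notin># \<mu>) \<and> represents a P c f \<and> represents b P c g"
  then show "alg_rel a b f g"
    by (auto simp: represents_def intro!: alg_rel_sum alg_rel_mult alg_rel_const alg_rel_prod_mset)
qed

lemma alg_ext_eqI:
  assumes "\<And>g g'. alg_rel a b f g \<Longrightarrow> alg_rel a b f g' \<Longrightarrow> g = g'" "alg_rel a b f g"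
  shows "alg_ext a b f = g"
proof -
  have "alg_ext a b f = (THE g. alg_rel a b f g)"
    unfolding alg_ext_def alg_rel_iff represents_def ..
  also have "\<dots> = g" using assms by blast
  finally show ?thesis .
qed

subsection \<open>Algebraic independence of the elementary symmetric functions\<close>

text \<open>The order is the multiset extension of the order on indices: the largest index with
  differing multiplicity decides. It is linear and compatible with addition, hence a monomial
  order.\<close>

definition lowest_monomial :: "pser \<Rightarrow> nat multiset \<Rightarrow> bool" where
  "lowest_monomial f M \<longleftrightarrow> coeff f M = 1 \<and> (\<forall>A<M. coeff f A = 0)"

text \<open>If \<open>A + B \<le> M + N\<close>, then \<open>A < M\<close> or \<open>B < N\<close>
  unless \<open>A = M\<close> and \<open>B = N\<close>; so at most one product of coefficients
  survives.\<close>

lemma lowest_monomial_mult: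
  assumes f: "lowest_monomial f M" and g: "lowest_monomial g N"
  shows "lowest_monomial (f * g) (M + N)"
proof -
  have zero: "coeff f A * coeff g B = 0" if "A < M \<or> B < N" for A B
    using that f g by (auto simp: lowest_monomial_def)
  have "coeff (f * g) (M + N) = (\<Sum>A \<in> {M}. coeff f A * coeff g (M + N - A))"
    unfolding coeff_mult
  proof (rule sum.mono_neutral_right[OF finite_submsets])
    show "\<forall>A\<in>{A. A \<subseteq># M + N} - {M}. coeff f A * coeff g (M + N - A) = 0"
    proof
      fix A assume A: "A \<in> {A. A \<subseteq># M + N} - {M}"
      then have "A + (M + N - A) = M + N" by auto
      moreover have "A \<noteq> M" using A by blast
      ultimately have "A < M \<or> M + N - A < N"
        using add_less_le_mono[of M A N "M + N - A"] by (cases A M rule: linorder_cases) (auto simp: not_less)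
      then show "coeff f A * coeff g (M + N - A) = 0" by (rule zero)
    qed
  qed auto
  moreover have "coeff (f * g) K = 0" if "K < M + N" for K
    unfolding coeff_mult
  proof (rule sum.neutral, safe)
    fix A assume "A \<subseteq># K"
    then have "A + (K - A) = K" by auto
    with that have "A < M \<or> K - A < N"
      using add_mono[of M A N "K - A"] by (metis not_less)
    then show "coeff f A * coeff g (K - A) = 0" by (rule zero)
  qed
  ultimately show ?thesis
    using f g by (simp add: lowest_monomial_def)
qed

lemma lowest_monomial_1: "lowest_monomial 1 {#}"
  by (auto simp: lowest_monomial_def coeff_1)

lemma squarefree_mset_conv: "(\<forall>i. count A i \<le> 1) \<longleftrightarrow> A = mset_set (set_mset A)"
proof
  assume le: "\<forall>i. count A i \<le> 1"
  show "A = mset_set (set_mset A)"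
  proof (rule multiset_eqI)
    fix i show "count A i = count (mset_set (set_mset A)) i"
      using le[rule_format, of i]
      by (cases "i \<in># A") (auto simp: le_Suc_eq simp flip: not_in_iff)
  qed
next
  assume "A = mset_set (set_mset A)"
  then show "\<forall>i. count A i \<le> 1"
    by (metis count_mset_set' le_numeral_extra(4) zero_le_one)
qed

text \<open>A squarefree monomial of degree \<open>n\<close> below this one cannot contain an index
  \<open>i \<ge> n\<close>, because that excess would have to be made up at a still larger index.
  Its \<open>n\<close> distinct indices are then those below \<open>n\<close>.\<close>

lemma lowest_monomial_esym: "lowest_monomial (esym n) (mset_set {..<n})"
proof -
  have "coeff (esym n) A = 0" if less: "A < mset_set {..<n}" for A
  proof (rule ccontr)
    assume "coeff (esym n) A \<noteq> 0"
    then have A: "size A = n" "\<And>i. count A i \<le> 1"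
      by (auto simp: coeff_esym split: if_splits)
    then have eq: "A = mset_set (set_mset A)"
      by (simp only: squarefree_mset_conv[symmetric]) simp
    have "i < n" if i: "i \<in># A" for i
    proof (rule ccontr)
      assume "\<not> i < n"
      with i have "count (mset_set {..<n}) i < count A i" by simp
      with less obtain j where "j > i" "count A j < count (mset_set {..<n}) j"
        unfolding less_multiset\<^sub>H\<^sub>O by blast
      with \<open>\<not> i < n\<close> show False by simp
    qed
    then have "set_mset A \<subseteq> {..<n}" by blast
    moreover have "card (set_mset A) = n" using A(1) eq by (metis size_mset_set)
    ultimately have "set_mset A = {..<n}" by (simp add: card_subset_eq)
    with eq less show False by simp
  qed
  then show ?thesis
    by (auto simp: lowest_monomial_def coeff_esym count_mset_set')
qed

lemma lowest_monomial_prod_esym: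
  "lowest_monomial (\<Prod>i\<in>#\<mu>. esym i) (\<Sum>i\<in>#\<mu>. mset_set {..<i})"
  by (induction \<mu>) (auto intro: lowest_monomial_mult lowest_monomial_1 lowest_monomial_esym)

text \<open>The multiplicity of \<open>j\<close> in this monomial is the number of parts of \<open>\<mu>\<close> exceeding \<open>j\<close>:
  it is the conjugate partition.\<close>

lemma inj_lowest_monomial:
  assumes eq: "(\<Sum>i\<in>#\<mu>. mset_set {..<i}) = (\<Sum>i\<in>#\<nu>. mset_set {..<i})"
    and "0 \<notin># \<mu>" "0 \<notin># \<nu>"
  shows "\<mu> = (\<nu> :: nat multiset)"
proof (rule multiset_eqI)
  have *: "count (\<Sum>i\<in>#\<rho>. mset_set {..<i}) j = size (filter_mset (\<lambda>i. j < i) \<rho>)" for \<rho> and j :: nat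
    by (induction \<rho>) (auto simp: count_mset_set')
  have **: "size (filter_mset (\<lambda>i. j < i) \<rho>) = count \<rho> (Suc j) + size (filter_mset (\<lambda>i. Suc j < i) \<rho>)"
    for \<rho> and j :: nat
    by (induction \<rho>) auto
  fix i show "count \<mu> i = count \<nu> i"
  proof (cases i)
    case 0
    with assms(2,3) show ?thesis by (simp add: not_in_iff)
  next
    case (Suc j)
    with **[of j \<mu>] **[of j \<nu>] *[of \<mu> j] *[of \<nu> j] *[of \<mu> "Suc j"] *[of \<nu> "Suc j"] eq
    show ?thesis by simp
  qed
qed

text \<open>Among the \<open>\<mu>\<close> with nonzero coefficient, take the one whose lowest
  monomial is least. No other product reaches this monomial, so its coefficient cannot
  cancel.\<close>

lemma esym_alg_independent:
  assumes "finite P" "\<forall>\<mu>\<in>P. 0 \<notin># \<mu>" "represents esym P c 0" "\<mu> \<in> P"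
  shows "c \<mu> = 0"
proof (rule ccontr)
  assume nz: "c \<mu> \<noteq> 0"
  define m where "m = (\<lambda>\<mu> :: nat multiset. \<Sum>i\<in>#\<mu>. mset_set {..<i})"
  define Q where "Q = {\<mu> \<in> P. c \<mu> \<noteq> 0}"
  have "finite (m ` Q)" "m ` Q \<noteq> {}" using assms nz by (auto simp: Q_def)
  then have "Min (m ` Q) \<in> m ` Q" by (rule Min_in)
  then obtain \<nu> where \<nu>: "\<nu> \<in> Q" "m \<nu> = Min (m ` Q)" by auto
  have min: "m \<nu> \<le> m \<rho>" if "\<rho> \<in> Q" for \<rho>
    using \<open>finite (m ` Q)\<close> that unfolding \<nu>(2) by simp
  have "0 = coeff (\<Sum>\<rho>\<in>P. const (c \<rho>) * (\<Prod>i\<in>#\<rho>. esym i)) (m \<nu>)"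
    using assms(3) by (metis represents_def coeff_0)
  also have "\<dots> = (\<Sum>\<rho>\<in>P. c \<rho> * coeff (\<Prod>i\<in>#\<rho>. esym i) (m \<nu>))"
    by (simp add: coeff_sum)
  also have "\<dots> = (\<Sum>\<rho>\<in>{\<nu>}. c \<rho> * coeff (\<Prod>i\<in>#\<rho>. esym i) (m \<nu>))"
  proof (rule sum.mono_neutral_right)
    show "\<forall>\<rho>\<in>P - {\<nu>}. c \<rho> * coeff (\<Prod>i\<in>#\<rho>. esym i) (m \<nu>) = 0"
    proof
      fix \<rho> assume \<rho>: "\<rho> \<in> P - {\<nu>}"
      show "c \<rho> * coeff (\<Prod>i\<in>#\<rho>. esym i) (m \<nu>) = 0"
      proof (cases "\<rho> \<in> Q")
        case True
        have "m \<rho> \<noteq> m \<nu>"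
          using inj_lowest_monomial[of \<rho> \<nu>] \<rho> \<nu>(1) assms(2) by (auto simp: m_def Q_def)
        with min[OF True] have "m \<nu> < m \<rho>" by simp
        then show ?thesis
          using lowest_monomial_prod_esym[of \<rho>] by (simp add: lowest_monomial_def m_def)
      next
        case False
        with \<rho> show ?thesis by (simp add: Q_def)
      qed
    qed
  qed (use assms \<nu> in \<open>auto simp: Q_def\<close>)
  also have "\<dots> = c \<nu>"
    using lowest_monomial_prod_esym[of \<nu>] by (simp add: lowest_monomial_def m_def)
  finally show False using \<nu>(1) by (simp add: Q_def)
qed

lemma alg_rel_esym_functional:
  assumes "alg_rel esym b f g" "alg_rel esym b f g'"
  shows "g = g'"
proof -
  have "alg_rel esym b 0 (g - g')" using alg_rel_diff[OF assms] by simp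
  then obtain P c where "finite P" "\<forall>\<mu>\<in>P. 0 \<notin># \<mu>" "represents esym P c 0" "represents b P c (g - g')"
    unfolding alg_rel_iff by blast
  with esym_alg_independent[of P c] have "g - g' = 0"
    by (auto simp: represents_def[of b])
  then show ?thesis by simp
qed

section \<open>Classical identities\<close>

lemma deg_part_series_homogeneous:
  assumes "\<And>r. homogeneous r (F r)"
  shows "deg_part n (series F) = F n"
proof -
  have "deg_part n (series F) = (\<Sum>r\<le>n. deg_part n (F r))"
    by (intro deg_part_series homogeneous_vanish_below assms)
  also have "\<dots> = (\<Sum>r\<le>n. if r = n then F n else 0)"
    by (intro sum.cong) (auto simp: homogeneous_deg_part[OF assms])
  finally show ?thesis by simp
qed

text \<open>Degreewise form of A(-t) B(t) = 1 for the two generating functions.\<close>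

definition dual :: "(nat \<Rightarrow> pser) \<Rightarrow> (nat \<Rightarrow> pser) \<Rightarrow> bool" where
  "dual a b \<longleftrightarrow> a 0 = 1 \<and> b 0 = 1 \<and> (\<forall>n\<ge>1. (\<Sum>i\<le>n. (-1) ^ i * (a i * b (n - i))) = 0)"

text \<open>The sign is \<open>(-1)\<^sup>t\<close>: the complete homogeneous functions satisfy this with \<open>t = 0\<close>
  and the elementary ones with \<open>t = 1\<close>.\<close>

definition newton :: "nat \<Rightarrow> (nat \<Rightarrow> pser) \<Rightarrow> (nat \<Rightarrow> pser) \<Rightarrow> bool" where
  "newton t p a \<longleftrightarrow> a 0 = 1 \<and>
    (\<forall>n\<ge>1. of_nat n * a n = (\<Sum>k=1..n. (-1) ^ (t * (k - 1)) * (p k * a (n - k))))"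

lemma hsym_0 [simp]: "hsym 0 = 1"
  and esym_0 [simp]: "esym 0 = 1"
  by (auto intro!: pser_eqI simp: coeff_hsym coeff_esym coeff_1)

lemma hsym_1: "hsym 1 = psym 1"
  and esym_1: "esym 1 = psym 1"
  by (auto intro!: pser_eqI simp: coeff_hsym coeff_esym coeff_psym size_1_singleton_mset
      dest: size_1_singleton_mset split: if_splits)

lemma sum_alternating_Pow:
  assumes "finite S" "S \<noteq> {}"
  shows "(\<Sum>T\<in>Pow S. (-1) ^ card T) = (0 :: complex)"
proof -
  have "(\<Sum>T\<in>Pow S. (-1) ^ card T) = (\<Prod>x\<in>S. (-1) + (1 :: complex))"
    unfolding prod_add[OF assms(1)] by simp
  also have "\<dots> = 0" using assms by (simp add: card_gt_0_iff)
  finally show ?thesis .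
qed

text \<open>In the convolution only squarefree submultisets of \<open>M\<close> count. They are the
  subsets of its support, and their signs cancel because the support is nonempty.\<close>

lemma dual_esym_hsym: "dual esym hsym"
  unfolding dual_def
proof (intro conjI allI impI)
  fix n :: nat assume n: "n \<ge> 1"
  show "(\<Sum>i\<le>n. (-1) ^ i * (esym i * hsym (n - i))) = 0"
  proof (rule pser_eqI)
    fix M
    have "coeff (\<Sum>i\<le>n. (-1) ^ i * (esym i * hsym (n - i))) M =
        (\<Sum>A | A \<subseteq># M. \<Sum>i\<le>n. (-1) ^ i * (coeff (esym i) A * coeff (hsym (n - i)) (M - A)))"
      unfolding coeff_sum coeff_signed_mult coeff_mult[of "esym _"] sum_distrib_left
      by (rule sum.swap)
    also have "\<dots> = (\<Sum>A | A \<subseteq># M. if size M = n \<and> A = mset_set (set_mset A) then (-1) ^ size A else 0)"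
    proof (rule sum.cong[OF refl])
      fix A assume "A \<in> {A. A \<subseteq># M}"
      then have A: "size (M - A) = size M - size A" "size A \<le> size M"
        by (auto simp: size_Diff_submset size_mset_mono)
      have "(\<Sum>i\<le>n. (-1) ^ i * (coeff (esym i) A * coeff (hsym (n - i)) (M - A))) =
          (\<Sum>i\<le>n. if i = size A then
            (if size M = n \<and> A = mset_set (set_mset A) then (-1) ^ size A else 0) else 0)"
        using A by (intro sum.cong) (auto simp: coeff_esym coeff_hsym simp flip: squarefree_mset_conv)
      with A show "(\<Sum>i\<le>n. (-1) ^ i * (coeff (esym i) A * coeff (hsym (n - i)) (M - A))) =
          (if size M = n \<and> A = mset_set (set_mset A) then (-1) ^ size A else 0)"
        by auto
    qed
    also have "\<dots> = 0"
    proof (cases "size M = n")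
      case True
      have "(\<Sum>A | A \<subseteq># M. if A = mset_set (set_mset A) then (-1) ^ size A else 0) =
          (\<Sum>A | A \<subseteq># M \<and> A = mset_set (set_mset A). (-1) ^ size A)"
        by (intro sum.mono_neutral_cong_right) (auto simp: finite_submsets)
      also have "\<dots> = (\<Sum>T\<in>Pow (set_mset M). (-1) ^ card T)"
      proof (rule sum.reindex_bij_witness[where i = mset_set and j = set_mset])
        fix T assume "T \<in> Pow (set_mset M)"
        then have "T \<subseteq> set_mset M" "finite T" using finite_subset by auto
        then show "mset_set T \<in> {A. A \<subseteq># M \<and> A = mset_set (set_mset A)}"
          by (auto simp: subseteq_mset_def count_mset_set' Suc_le_eq)
        show "set_mset (mset_set T) = T" using \<open>finite T\<close> by simp
      next
        fix A assume A: "A \<in> {A. A \<subseteq># M \<and> A = mset_set (set_mset A)}"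
        then show "mset_set (set_mset A) = A" "set_mset A \<in> Pow (set_mset M)"
          by (auto dest: mset_subset_eqD)
        from A show "(-1) ^ card (set_mset A) = (-1) ^ size A"
          using size_mset_set[of "set_mset A"] by simp
      qed
      also have "\<dots> = (0 :: complex)"
        using True n by (intro sum_alternating_Pow) auto
      finally show ?thesis using True by simp
    qed auto
    finally show "coeff (\<Sum>i\<le>n. (-1) ^ i * (esym i * hsym (n - i))) M = coeff 0 M" by simp
  qed
qed simp_all

text \<open>For \<open>size M = n\<close>, the coefficient of p_k h_(n-k) at \<open>M\<close> is the
  number of indices of multiplicity at least \<open>k\<close>. Summed over \<open>k\<close>, each
  index counts as often as it occurs, which gives \<open>n\<close>.\<close>

lemma newton_hsym: "newton 0 psym hsym"
  unfolding newton_def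
proof (intro conjI allI impI)
  fix n :: nat assume n: "n \<ge> 1"
  have "coeff (of_nat n * hsym n) M = coeff (\<Sum>k=1..n. psym k * hsym (n - k)) M" for M
  proof -
    have "coeff (psym k * hsym (n - k)) M =
        (\<Sum>i\<in>set_mset M. if size M = n \<and> k \<le> count M i then 1 else 0)" if k: "k \<in> {1..n}" for k
    proof -
      have "coeff (psym k * hsym (n - k)) M =
          (\<Sum>A\<in>(\<lambda>i. replicate_mset k i) ` {i. k \<le> count M i}.
            coeff (psym k) A * coeff (hsym (n - k)) (M - A))"
        unfolding coeff_mult
      proof (rule sum.mono_neutral_right[OF finite_submsets])
        show "(\<lambda>i. replicate_mset k i) ` {i. k \<le> count M i} \<subseteq> {A. A \<subseteq># M}"
          by (auto simp: subseteq_mset_def)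
        show "\<forall>A\<in>{A. A \<subseteq># M} - replicate_mset k ` {i. k \<le> count M i}.
            coeff (psym k) A * coeff (hsym (n - k)) (M - A) = 0"
          by (auto simp: coeff_psym count_le_replicate_mset_subset_eq)
      qed
      also have "\<dots> = (\<Sum>i | k \<le> count M i. if size M = n then 1 else 0)"
      proof (subst sum.reindex)
        show "inj_on (replicate_mset k) {i. k \<le> count M i}"
          using k by (auto simp: inj_on_def replicate_mset_eq_iff)
        show "sum ((\<lambda>A. coeff (psym k) A * coeff (hsym (n - k)) (M - A)) \<circ> replicate_mset k)
            {i. k \<le> count M i} = (\<Sum>i | k \<le> count M i. if size M = n then 1 else 0)"
        proof (rule sum.cong[OF refl])
          fix i assume "i \<in> {i. k \<le> count M i}"
          then have "replicate_mset k i \<subseteq># M" by (simp add: count_le_replicate_mset_subset_eq)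
          then have "size (M - replicate_mset k i) = size M - k" "k \<le> size M"
            by (auto simp: size_Diff_submset dest: size_mset_mono)
          with k show "((\<lambda>A. coeff (psym k) A * coeff (hsym (n - k)) (M - A)) \<circ> replicate_mset k) i =
              (if size M = n then 1 else 0)"
            by (auto simp: coeff_psym coeff_hsym)
        qed
      qed
      also have "\<dots> = (\<Sum>i\<in>set_mset M. if size M = n \<and> k \<le> count M i then 1 else 0)"
      proof (rule sum.mono_neutral_cong_left)
        show "{i. k \<le> count M i} \<subseteq> set_mset M"
          using k by (auto simp flip: count_greater_zero_iff)
      qed auto
      finally show ?thesis .
    qed
    then have "coeff (\<Sum>k=1..n. psym k * hsym (n - k)) M =
        (\<Sum>k=1..n. \<Sum>i\<in>set_mset M. if size M = n \<and> k \<le> count M i then 1 else 0)"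
      unfolding coeff_sum by (intro sum.cong) auto
    also have "\<dots> = (\<Sum>i\<in>set_mset M. \<Sum>k=1..n. if size M = n \<and> k \<le> count M i then 1 else 0)"
      by (rule sum.swap)
    also have "\<dots> = (\<Sum>i\<in>set_mset M. if size M = n then of_nat (count M i) else 0)"
    proof (rule sum.cong[OF refl])
      fix i
      have "{1..n} \<inter> {k. k \<le> count M i} = {1..count M i}" if "size M = n"
        using that count_le_size[of M i] by auto
      then show "(\<Sum>k=1..n. if size M = n \<and> k \<le> count M i then 1 else 0) =
          (if size M = n then of_nat (count M i) else (0 :: complex))"
        by (auto simp: sum.If_cases)
    qed
    also have "\<dots> = coeff (of_nat n * hsym n) M"
      by (auto simp: coeff_hsym size_multiset_overloaded_eq)
    finally show ?thesis by simp
  qed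
  then show "of_nat n * hsym n = (\<Sum>k=1..n. (-1) ^ (0 * (k - 1)) * (psym k * hsym (n - k)))"
    by (auto intro: pser_eqI)
qed simp

lemma series_dual:
  assumes "dual a b" "\<And>r. vanish_below r (a r)" "\<And>r. vanish_below r (b r)"
  shows "series (\<lambda>n. (-1) ^ n * a n) * series b = 1"
proof -
  have "series (\<lambda>n. (-1) ^ n * a n) * series b = series (\<lambda>n. \<Sum>i\<le>n. (-1) ^ i * a i * b (n - i))"
    using assms by (intro series_mult vanish_below_signed)
  also have "\<dots> = series (\<lambda>n. if n = 0 then 1 else 0)"
    using assms(1) by (intro series_cong) (auto simp: dual_def mult.assoc)
  finally show ?thesis by (simp add: series_singleton)
qed

text \<open>Let H be the series of the \<open>hsym n\<close> and P that of the power sums.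
  Differentiating E H = 1 turns D H = P H into D E = - P E, whose component of degree
  \<open>n\<close> is the claim up to signs.\<close>

lemma newton_esym: "newton 1 psym esym"
  unfolding newton_def
proof (intro conjI allI impI)
  fix n :: nat assume n: "n \<ge> 1"
  \<comment> \<open>\<open>psym 0\<close> is the series 1, so index 0 is blanked out before
    convolving over all \<open>i \<le> n\<close>.\<close>
  define p where "p = (\<lambda>k. if k = 0 then 0 else psym k)"
  define E where "E = series (\<lambda>n. (-1) ^ n * esym n)"
  note hom = homogeneous_sym
  note van = hom[THEN homogeneous_vanish_below]
  have van_p: "vanish_below r (p r)" for r
    using van by (simp add: p_def)
  have "E * series hsym = 1"
    unfolding E_def by (rule series_dual[OF dual_esym_hsym]) (intro van)+
  have "euler (series hsym) = series (\<lambda>n. \<Sum>i\<le>n. p i * hsym (n - i))"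
    unfolding euler_series[OF van(1)]
  proof (rule series_cong)
    fix r
    have "euler (hsym r) = of_nat r * hsym r" by (rule euler_homogeneous[OF hom(1)])
    also have "\<dots> = (\<Sum>k=1..r. psym k * hsym (r - k))"
      using newton_hsym by (cases "r = 0") (auto simp: newton_def)
    also have "\<dots> = (\<Sum>i\<le>r. p i * hsym (r - i))"
      by (rule sum.mono_neutral_cong_left) (auto simp: p_def)
    finally show "euler (hsym r) = \<dots>" .
  qed
  also have "\<dots> = series p * series hsym"
    by (rule series_mult[OF van_p van(1), symmetric])
  finally have "0 = euler E * series hsym + E * (series p * series hsym)"
    using euler_mult[of E "series hsym"] \<open>E * series hsym = 1\<close> by simp
  \<comment> \<open>Multiplying by \<open>E\<close> allows the factor \<open>series hsym\<close> to
    be removed.\<close>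
  then have "0 = E * (euler E * series hsym + E * (series p * series hsym))" by simp
  also have "\<dots> = (euler E + E * series p) * (E * series hsym)" by (simp add: algebra_simps)
  finally have "euler E = - (series p * E)"
    using \<open>E * series hsym = 1\<close> by (simp add: eq_neg_iff_add_eq_0 mult.commute)
  then have "deg_part n (euler E) = - deg_part n (series p * E)"
    by (simp add: deg_part_uminus)
  have signed: "homogeneous r ((-1) ^ r * esym r)" for r
    using hom(2)[of r] by (auto simp: homogeneous_def)
  have pe: "homogeneous r (\<Sum>i\<le>r. p i * ((-1) ^ (r - i) * esym (r - i)))" for r
  proof -
    have "homogeneous (i + (r - i)) (p i * ((-1) ^ (r - i) * esym (r - i)))" for i
      using homogeneous_mult[OF hom(3)[of i] signed[of "r - i"]]
      by (auto simp: p_def homogeneous_def)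
    then have "\<forall>i\<le>r. homogeneous r (p i * ((-1) ^ (r - i) * esym (r - i)))"
      by (metis le_add_diff_inverse)
    then show ?thesis by (intro homogeneous_sum) auto
  qed
  have "series p * E = series (\<lambda>r. \<Sum>i\<le>r. p i * ((-1) ^ (r - i) * esym (r - i)))"
    unfolding E_def by (rule series_mult[OF van_p vanish_below_signed[OF van(2)]])
  then have "deg_part n (series p * E) = (\<Sum>i\<le>n. p i * ((-1) ^ (n - i) * esym (n - i)))"
    using deg_part_series_homogeneous[OF pe] by simp
  moreover have "deg_part n (euler E) = (-1) ^ n * (of_nat n * esym n)"
  proof -
    have "deg_part n (euler E) = euler (deg_part n E)"
      by (auto intro!: pser_eqI simp: coeff_deg_part coeff_euler)
    also have "\<dots> = (-1) ^ n * euler (esym n)"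
      unfolding E_def deg_part_series_homogeneous[OF signed] by (rule euler_signed)
    finally show ?thesis by (simp add: euler_homogeneous[OF hom(2)])
  qed
  ultimately have "(-1) ^ n * (of_nat n * esym n) = - (\<Sum>i\<le>n. p i * ((-1) ^ (n - i) * esym (n - i)))"
    using \<open>deg_part n (euler E) = - deg_part n (series p * E)\<close> by simp
  then have "(-1) ^ n * ((-1) ^ n * (of_nat n * esym n)) =
      (-1) ^ n * - (\<Sum>i\<le>n. p i * ((-1) ^ (n - i) * esym (n - i)))" by simp
  then have "of_nat n * esym n = (\<Sum>i\<le>n. (-1) ^ Suc n * (p i * ((-1) ^ (n - i) * esym (n - i))))"
    by (simp add: sum_distrib_left sum_negf flip: mult.assoc power_add mult_2)
  also have "\<dots> = (\<Sum>k=1..n. (-1) ^ (1 * (k - 1)) * (psym k * esym (n - k)))"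
  proof (rule sum.mono_neutral_cong_right)
    fix k assume "k \<in> {1..n}"
    \<comment> \<open>The exponents \<open>k - 1\<close> and \<open>2 * n + 1 - k\<close> have the
      same parity.\<close>
    then have "(-1 :: pser) ^ (1 * (k - 1)) = (-1) ^ (Suc n + (n - k))"
      by (auto simp: minus_one_power_iff)
    then show "(-1) ^ Suc n * (p k * ((-1) ^ (n - k) * esym (n - k))) =
        (-1) ^ (1 * (k - 1)) * (psym k * esym (n - k))"
      using \<open>k \<in> {1..n}\<close> by (simp only: power_add mult_ac) (simp add: p_def)
  qed (auto simp: p_def)
  finally show "of_nat n * esym n = \<dots>" .
qed simp

section \<open>Expressing one family of generators through another\<close>

lemma dual_sym:
  assumes "dual a b"
  shows "dual b a"
  unfolding dual_def
proof (intro conjI allI impI)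
  fix n :: nat assume "n \<ge> 1"
  have "(\<Sum>i\<le>n. (-1) ^ i * (b i * a (n - i))) = (\<Sum>i\<le>n. (-1) ^ (n - i) * (b (n - i) * a i))"
    by (rule sum.reindex_bij_witness[where i = "\<lambda>i. n - i" and j = "\<lambda>i. n - i"]) auto
  also have "\<dots> = (\<Sum>i\<le>n. (-1) ^ n * ((-1) ^ i * (a i * b (n - i))))"
    by (rule sum.cong) (auto simp: minus_one_power_iff mult.commute)
  also have "\<dots> = 0"
    using assms \<open>n \<ge> 1\<close> by (simp add: dual_def flip: sum_distrib_left)
  finally show "(\<Sum>i\<le>n. (-1) ^ i * (b i * a (n - i))) = 0" .
qed (use assms in \<open>auto simp: dual_def\<close>)

text \<open>The dual relation can be solved for \<open>b n\<close>, so \<open>b n\<close> is a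
  polynomial in the \<open>a i\<close> that is the same for every dual pair. Applied to the pairs
  (h, e) and (e, h), this says that the involution sends e_n to h_n.\<close>

lemma alg_rel_dual:
  assumes "dual a b" "dual a' b'"
  shows "alg_rel a a' (b n) (b' n)"
proof (induction n rule: less_induct)
  case (less n)
  have rec: "d n = - (\<Sum>i=1..n. (-1) ^ i * (c i * d (n - i)))" if "dual c d" "n \<ge> 1" for c d
  proof -
    have "0 = (\<Sum>i\<le>n. (-1) ^ i * (c i * d (n - i)))" using that by (simp add: dual_def)
    also have "\<dots> = d n + (\<Sum>i=1..n. (-1) ^ i * (c i * d (n - i)))"
      using that by (simp add: dual_def sum.atLeast1_atMost_eq atMost_atLeast0 sum.atLeast_Suc_atMost)
    finally show ?thesis by (simp add: eq_neg_iff_add_eq_0)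
  qed
  show ?case
  proof (cases "n = 0")
    case True
    with assms show ?thesis by (simp add: dual_def alg_rel_1)
  next
    case False
    have "alg_rel a a' (0 - (\<Sum>i=1..n. (-1) ^ i * (a i * b (n - i))))
        (0 - (\<Sum>i=1..n. (-1) ^ i * (a' i * b' (n - i))))"
      by (intro alg_rel_diff alg_rel_0 alg_rel_sum alg_rel_signed alg_rel_mult less.IH alg_rel_gen) auto
    with False show ?thesis by (simp add: rec[OF assms(1)] rec[OF assms(2)])
  qed
qed

lemma inverse_nat_mult_pser: "n \<noteq> 0 \<Longrightarrow> const (1 / of_nat n) * (of_nat n * f) = f"
  by (simp flip: const_of_nat const_mult mult.assoc)

text \<open>Dividing the recursion by \<open>n\<close> writes \<open>a n\<close> as a polynomial in
  the \<open>p k\<close> that depends only on \<open>t\<close> and \<open>n\<close>.\<close>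

lemma alg_rel_newton:
  assumes "newton t p a" "newton t p' a'"
  shows "alg_rel p p' (a n) (a' n)"
proof (induction n rule: less_induct)
  case (less n)
  have rec: "d n = const (1 / of_nat n) * (\<Sum>k=1..n. (-1) ^ (t * (k - 1)) * (c k * d (n - k)))"
    if "newton t c d" "n \<ge> 1" for c d
    using that inverse_nat_mult_pser[of n "d n"] by (simp add: newton_def)
  show ?case
  proof (cases "n = 0")
    case True
    with assms show ?thesis by (simp add: newton_def alg_rel_1)
  next
    case False
    then have "n \<ge> 1" by simp
    show ?thesis
      unfolding rec[OF assms(1) \<open>n \<ge> 1\<close>] rec[OF assms(2) \<open>n \<ge> 1\<close>]
      by (intro alg_rel_mult alg_rel_const alg_rel_sum alg_rel_signed less.IH alg_rel_gen) auto
  qed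
qed

text \<open>As \<open>a 0 = 1\<close>, the last term of the recursion is a sign times
  \<open>p n\<close>, so the recursion can also be solved for \<open>p n\<close>.\<close>

lemma alg_rel_newton_inverse:
  assumes "newton t p a" "newton t p' a'" "n \<ge> 1"
  shows "alg_rel a a' (p n) (p' n)"
  using \<open>n \<ge> 1\<close>
proof (induction n rule: less_induct)
  case (less n)
  have rec: "c n = (-1) ^ (t * (n - 1)) * (of_nat n * d n -
      (\<Sum>k=1..<n. (-1) ^ (t * (k - 1)) * (c k * d (n - k))))" if "newton t c d" for c d
  proof -
    have "of_nat n * d n = (\<Sum>k=1..n. (-1) ^ (t * (k - 1)) * (c k * d (n - k)))"
      using that less.prems by (simp add: newton_def)
    also have "{1..n} = insert n {1..<n}" using less.prems by auto
    finally have "of_nat n * d n - (\<Sum>k=1..<n. (-1) ^ (t * (k - 1)) * (c k * d (n - k))) =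
        (-1) ^ (t * (n - 1)) * c n"
      using that by (simp add: newton_def)
    then show ?thesis by (simp flip: mult.assoc power_add mult_2)
  qed
  have "alg_rel a a' (of_nat n) (of_nat n)"
    by (metis alg_rel_const const_of_nat)
  then show ?case
    unfolding rec[OF assms(1)] rec[OF assms(2)] using less.prems
    by (intro alg_rel_signed alg_rel_diff alg_rel_mult alg_rel_sum less.IH alg_rel_gen) auto
qed

text \<open>The value at \<open>n\<close> refers to all earlier values, hence \<open>wfrec\<close>.
  With \<open>p k = power_subst k x\<close> this constructs the plethysms by
  \<open>x\<close>.\<close>

lemma ex_newton: "\<exists>a. newton t p a"
proof -
  define F where "F = (\<lambda>(a :: nat \<Rightarrow> pser) n. if n = 0 then 1 else
    const (1 / of_nat n) * (\<Sum>k=1..n. (-1) ^ (t * (k - 1)) * (p k * a (n - k))))"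
  have "F f n = F g n" if "\<forall>m. (m, n) \<in> less_than \<longrightarrow> f m = g m" for f g n
    using that by (auto simp: F_def intro!: sum.cong arg_cong2[of _ _ _ _ "(*)"])
  then have "adm_wf less_than F" unfolding adm_wf_def by blast
  then have unfold: "wfrec less_than F n = F (wfrec less_than F) n" for n
    by (metis wf_less_than wfrec_fixpoint)
  have "newton t p (wfrec less_than F)"
    unfolding newton_def
  proof (intro conjI allI impI)
    show "wfrec less_than F 0 = 1" by (subst unfold) (simp add: F_def)
    fix n :: nat assume "n \<ge> 1"
    then have "of_nat n * const (1 / of_nat n) = 1"
      by (simp flip: const_of_nat const_mult)
    with \<open>n \<ge> 1\<close> show "of_nat n * wfrec less_than F n =
        (\<Sum>k=1..n. (-1) ^ (t * (k - 1)) * (p k * wfrec less_than F (n - k)))"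
      by (subst unfold) (simp add: F_def flip: mult.assoc)
  qed
  then show ?thesis by blast
qed

text \<open>Any images prescribed for the power sums extend, by Newton's recursion, to images of the
  elementary symmetric functions; hence independence of the latter suffices.\<close>

lemma alg_rel_psym_functional:
  assumes "alg_rel psym b f g" "alg_rel psym b f g'"
  shows "g = g'"
proof -
  obtain e where "newton 1 b e" using ex_newton by blast
  then have "alg_rel esym e (psym n) (b n)" if "n \<ge> 1" for n
    using alg_rel_newton_inverse[OF newton_esym] that by blast
  then show ?thesis
    using alg_rel_trans assms alg_rel_esym_functional by blast
qed

section \<open>Evaluating the involution and plethysm\<close>

lemma omega_eqI:
  assumes "alg_rel hsym esym f g"
  shows "omega f = g"
  unfolding omega_def
proof (rule alg_ext_eqI[OF _ assms])
  \<comment> \<open>Sending e to h also sends each h_n to e_n, so a pair related by exchanging h for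
    e is related by exchanging e for h, where uniqueness is known.\<close>
  have swap: "alg_rel esym hsym f g" if "alg_rel hsym esym f g" for f g
    using that by (rule alg_rel_trans) (intro alg_rel_dual dual_esym_hsym dual_sym[OF dual_esym_hsym])
  fix f g g' assume "alg_rel hsym esym f g" "alg_rel hsym esym f g'"
  then have "alg_rel esym hsym f g" "alg_rel esym hsym f g'" by (blast intro: swap)+
  then show "g = g'" by (rule alg_rel_esym_functional)
qed

lemma plethysm_eqI: "alg_rel psym (\<lambda>k. power_subst k x) f g \<Longrightarrow> plethysm f x = g"
  unfolding plethysm_def by (rule alg_ext_eqI[OF alg_rel_psym_functional])

text \<open>A polynomial in the power sums is one in the \<open>hsym n\<close>, so it has an image
  under the involution.\<close>

lemma alg_rel_hsym_of_psym:
  assumes "alg_rel psym psym f g"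
  shows "\<exists>g'. alg_rel hsym esym g g'"
proof -
  have "alg_rel hsym hsym f g"
    using alg_rel_trans[OF assms alg_rel_newton_inverse[OF newton_hsym newton_hsym]] .
  moreover have "f = g" if "alg_rel a a f g" for a f g
    using that by induction auto
  ultimately show ?thesis using alg_rel_change_target by blast
qed

section \<open>Plethysm of a Newton pair\<close>

text \<open>Solving the recursion with p_k[x] in place of p_k yields candidates \<open>a'\<close>.
  They arise from the \<open>a r\<close> by the substitution that defines plethysm, so uniqueness
  identifies them with it.\<close>

lemma newton_plethysm:
  assumes "newton t psym a"
  shows "newton t (\<lambda>k. power_subst k x) (\<lambda>r. plethysm (a r) x)"
    and "alg_rel psym (\<lambda>k. power_subst k x) (a r) (plethysm (a r) x)"
proof -
  obtain a' where a': "newton t (\<lambda>k. power_subst k x) a'" using ex_newton by blast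
  have rel: "alg_rel psym (\<lambda>k. power_subst k x) (a r) (a' r)" for r
    by (rule alg_rel_newton[OF assms a'])
  then have "plethysm (a r) x = a' r" for r by (rule plethysm_eqI)
  with a' rel show "newton t (\<lambda>k. power_subst k x) (\<lambda>r. plethysm (a r) x)"
    "alg_rel psym (\<lambda>k. power_subst k x) (a r) (plethysm (a r) x)" by simp_all
qed

text \<open>The dual relation is a polynomial identity, and substitution preserves it because the
  image of 0 is unique.\<close>

lemma dual_plethysm:
  assumes "newton t psym a" "newton t' psym b" "dual a b"
  shows "dual (\<lambda>r. plethysm (a r) x) (\<lambda>r. plethysm (b r) x)"
  unfolding dual_def
proof (intro conjI allI impI)
  show "plethysm (a 0) x = 1" "plethysm (b 0) x = 1"
    using assms by (auto simp: newton_def intro!: plethysm_eqI alg_rel_1)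
  fix n :: nat assume n: "n \<ge> 1"
  have "alg_rel psym (\<lambda>k. power_subst k x) (\<Sum>i\<le>n. (-1) ^ i * (a i * b (n - i)))
      (\<Sum>i\<le>n. (-1) ^ i * (plethysm (a i) x * plethysm (b (n - i)) x))"
    by (intro alg_rel_sum alg_rel_signed alg_rel_mult newton_plethysm(2)[OF assms(1)]
        newton_plethysm(2)[OF assms(2)])
  then show "(\<Sum>i\<le>n. (-1) ^ i * (plethysm (a i) x * plethysm (b (n - i)) x)) = 0"
    using assms(3) n alg_rel_0 alg_rel_psym_functional by (auto simp: dual_def)
qed

text \<open>The unit law of plethysm. It makes the series of the \<open>a r\<close> the case
  \<open>x = psym 1\<close> of a series of plethysms.\<close>

lemma plethysm_psym_1:
  assumes "newton t psym a"
  shows "plethysm (a r) (psym 1) = a r"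
proof (rule plethysm_eqI)
  show "alg_rel psym (\<lambda>k. power_subst k (psym 1)) (a r) (a r)"
  proof (rule alg_rel_trans)
    show "alg_rel psym psym (a r) (a r)" by (rule alg_rel_newton[OF assms assms])
    show "alg_rel psym (\<lambda>k. power_subst k (psym 1)) (psym n) (psym n)" if "n \<ge> 1" for n
      using alg_rel_gen[OF that, of psym "\<lambda>k. power_subst k (psym 1)"] power_subst_psym[OF that, of 1]
      by simp
  qed
qed

text \<open>In Newton's recursion p_k[x] starts in degree \<open>k\<close> or later and the other
  factor in degree \<open>r - k\<close> or later. Hence the sum over \<open>r\<close>
  converges.\<close>

lemma vanish_below_plethysm:
  assumes "newton t psym a" "vanish_below 1 x"
  shows "vanish_below r (plethysm (a r) x)"
proof (induction r rule: less_induct)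
  case (less r)
  show ?case
  proof (cases "r = 0")
    case False
    have "vanish_below r ((-1) ^ (t * (k - 1)) * (power_subst k x * plethysm (a (r - k)) x))"
      if "k \<in> {1..r}" for k
    proof -
      have "vanish_below (k * 1 + (r - k)) (power_subst k x * plethysm (a (r - k)) x)"
        using that assms(2) less.IH by (intro vanish_below_mult vanish_below_power_subst) auto
      with that show ?thesis by (intro vanish_below_signed) simp
    qed
    then have "vanish_below r (of_nat r * plethysm (a r) x)"
      using newton_plethysm(1)[OF assms(1), of x] False
      by (auto simp: newton_def intro!: vanish_below_sum)
    with False show ?thesis by (simp add: vanish_below_def)
  qed simp
qed

text \<open>If A = exp(sum of signed q_k/k), then D A = (sum of signed u_k) A; this is its part of
  index \<open>r\<close>, obtained by differentiating the recursion instead of an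
  exponential.\<close>

lemma euler_newton:
  assumes "newton t q a" and u: "\<And>k. k \<ge> 1 \<Longrightarrow> euler (q k) = of_nat k * u k"
  shows "euler (a r) = (\<Sum>k=1..r. (-1) ^ (t * (k - 1)) * (u k * a (r - k)))"
proof (induction r rule: less_induct)
  case (less r)
  define s where "s = (\<lambda>k. (-1 :: pser) ^ (t * (k - 1)))"
  have a: "of_nat n * a n = (\<Sum>k=1..n. s k * (q k * a (n - k)))" for n
    using assms(1) by (cases "n = 0") (auto simp: newton_def s_def)
  show ?case
  proof (cases "r = 0")
    case True
    with assms(1) show ?thesis by (simp add: newton_def)
  next
    case False
    have "of_nat r * euler (a r) = (\<Sum>k=1..r. s k * euler (q k * a (r - k)))"
      by (simp add: a euler_sum euler_signed s_def flip: euler_of_nat_mult)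
    also have "\<dots> = (\<Sum>k=1..r. of_nat k * (s k * (u k * a (r - k))))
        + (\<Sum>k=1..r. s k * (q k * euler (a (r - k))))"
      by (simp add: euler_mult u algebra_simps flip: sum.distrib)
    also have "(\<Sum>k=1..r. s k * (q k * euler (a (r - k)))) =
        (\<Sum>k=1..r. \<Sum>j=1..r - k. s k * q k * (s j * (u j * a (r - k - j))))"
    proof (rule sum.cong[OF refl])
      fix k assume "k \<in> {1..r}"
      then have "euler (a (r - k)) = (\<Sum>j=1..r - k. s j * (u j * a (r - k - j)))"
        unfolding s_def by (intro less.IH) auto
      then show "s k * (q k * euler (a (r - k))) =
          (\<Sum>j=1..r - k. s k * q k * (s j * (u j * a (r - k - j))))"
        by (simp add: sum_distrib_left mult.assoc)
    qed
    \<comment> \<open>With \<open>k\<close> as the inner index, the inner sum is the recursion for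
      \<open>a (r - j)\<close> and contributes the factor \<open>r - j\<close>.\<close>
    also have "\<dots> = (\<Sum>j=1..r. \<Sum>k=1..r - j. s j * u j * (s k * (q k * a (r - j - k))))"
      unfolding sum.Sigma[OF finite_atLeastAtMost ballI[OF finite_atLeastAtMost]]
      by (rule sum.reindex_bij_witness[where i = "\<lambda>(j, k). (k, j)" and j = "\<lambda>(k, j). (j, k)"])
        (auto simp: mult_ac diff_commute add.commute)
    also have "\<dots> = (\<Sum>j=1..r. of_nat (r - j) * (s j * (u j * a (r - j))))"
    proof (rule sum.cong[OF refl])
      fix j
      have "(\<Sum>k=1..r - j. s j * u j * (s k * (q k * a (r - j - k)))) =
          s j * u j * (of_nat (r - j) * a (r - j))"
        unfolding a by (rule sum_distrib_left[symmetric])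
      also have "\<dots> = of_nat (r - j) * (s j * (u j * a (r - j)))"
        by (simp only: mult.assoc mult.left_commute)
      finally show "(\<Sum>k=1..r - j. s j * u j * (s k * (q k * a (r - j - k)))) = \<dots>" .
    qed
    \<comment> \<open>The weights \<open>k\<close> and \<open>r - k\<close> add up to
      \<open>r\<close>, which is cancelled at the end.\<close>
    also have "(\<Sum>k=1..r. of_nat k * (s k * (u k * a (r - k)))) + \<dots> =
        (\<Sum>k=1..r. of_nat r * (s k * (u k * a (r - k))))"
      unfolding sum.distrib[symmetric]
    proof (rule sum.cong[OF refl])
      fix k assume "k \<in> {1..r}"
      then have "(of_nat r :: pser) = of_nat k + of_nat (r - k)"
        by (simp flip: of_nat_add)
      then show "of_nat k * (s k * (u k * a (r - k))) + of_nat (r - k) * (s k * (u k * a (r - k))) =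
          of_nat r * (s k * (u k * a (r - k)))"
        by (simp add: distrib_right)
    qed
    finally have "of_nat r * euler (a r) = of_nat r * (\<Sum>k=1..r. s k * (u k * a (r - k)))"
      unfolding sum_distrib_left .
    then show ?thesis
      unfolding s_def using False by (rule of_nat_mult_cancel_pser)
  qed
qed

text \<open>The image under the Euler derivation of the logarithm of the series of all
  \<open>plethysm (a r) x\<close>.\<close>

definition log_deriv :: "nat \<Rightarrow> pser \<Rightarrow> pser" where
  "log_deriv t x =
    series (\<lambda>k. if k = 0 then 0 else (-1) ^ (t * (k - 1)) * power_subst k (euler x))"

lemma vanish_below_log_deriv:
  "vanish_below k (if k = 0 then 0 else (-1) ^ (t * (k - 1)) * power_subst k (euler x))"
proof -
  \<comment> \<open>\<open>euler\<close> kills the constant term.\<close>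
  have "vanish_below 1 (euler x)" by (simp add: vanish_below_def coeff_euler)
  then have "vanish_below (k * 1) (power_subst k (euler x))" if "k \<noteq> 0"
    using that by (intro vanish_below_power_subst) auto
  then show ?thesis by (auto intro: vanish_below_signed)
qed

lemma euler_series_plethysm:
  assumes a: "newton t psym a" and x: "vanish_below 1 x"
  shows "euler (series (\<lambda>r. plethysm (a r) x)) = log_deriv t x * series (\<lambda>r. plethysm (a r) x)"
proof -
  note van = vanish_below_plethysm[OF a x]
  have "euler (plethysm (a r) x) =
      (\<Sum>k=1..r. (-1) ^ (t * (k - 1)) * (power_subst k (euler x) * plethysm (a (r - k)) x))" for r
    by (intro euler_newton[OF newton_plethysm(1)[OF a]] euler_power_subst)
  then have "euler (series (\<lambda>r. plethysm (a r) x)) =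
      series (\<lambda>r. \<Sum>k=1..r. (-1) ^ (t * (k - 1)) * (power_subst k (euler x) * plethysm (a (r - k)) x))"
    unfolding euler_series[OF van] by presburger
  also have "\<dots> = series (\<lambda>r. \<Sum>k\<le>r. (if k = 0 then 0
      else (-1) ^ (t * (k - 1)) * power_subst k (euler x)) * plethysm (a (r - k)) x)"
    by (intro series_cong sum.mono_neutral_cong_left) (auto simp: mult.assoc)
  also have "\<dots> = log_deriv t x * series (\<lambda>r. plethysm (a r) x)"
    unfolding log_deriv_def by (rule series_mult[OF vanish_below_log_deriv van, symmetric])
  finally show ?thesis .
qed

lemma deg_part_eqI: "(\<And>n. deg_part n f = deg_part n g) \<Longrightarrow> f = g"
  by (rule pser_eqI) (metis coeff_deg_part)

lemma deg_part_log_deriv: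
  assumes "N \<ge> 1"
  shows "deg_part N (log_deriv t x) = (\<Sum>k | k dvd N.
    (-1) ^ (t * (k - 1)) * power_subst k (of_nat (N div k) * deg_part (N div k) x))"
proof -
  have euler: "deg_part n (euler x) = of_nat n * deg_part n x" for n
    by (rule pser_eqI) (simp add: coeff_deg_part coeff_euler)
  have "deg_part N (log_deriv t x) = (\<Sum>k\<le>N. deg_part N
      (if k = 0 then 0 else (-1) ^ (t * (k - 1)) * power_subst k (euler x)))"
    unfolding log_deriv_def by (rule deg_part_series[OF vanish_below_log_deriv])
  also have "\<dots> = (\<Sum>k | k dvd N.
      (-1) ^ (t * (k - 1)) * power_subst k (of_nat (N div k) * deg_part (N div k) x))"
    using assms
    by (intro sum.mono_neutral_cong_right)
      (auto simp: deg_part_signed deg_part_power_subst euler dvd_imp_le Suc_le_eq)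
  finally show ?thesis .
qed

lemma log_deriv_add: "log_deriv t (x + y) = log_deriv t x + log_deriv t y"
proof (rule deg_part_eqI)
  fix n
  show "deg_part n (log_deriv t (x + y)) = deg_part n (log_deriv t x + log_deriv t y)"
  proof (cases "n = 0")
    case True
    have "deg_part 0 (log_deriv t z) = 0" for z
      unfolding log_deriv_def by (subst deg_part_series[OF vanish_below_log_deriv]) simp
    with True show ?thesis by (simp add: deg_part_add)
  next
    case False
    then show ?thesis
      by (simp add: deg_part_add deg_part_log_deriv power_subst_add distrib_left sum.distrib)
  qed
qed

lemma geometric_series:
  assumes "homogeneous 1 p"
  shows "(1 - p) * series (\<lambda>n. p ^ n) = 1"
proof (rule deg_part_eqI)
  fix n
  have hom: "homogeneous r (p ^ r)" for r
    using homogeneous_power[OF assms, of r] by simp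
  have "deg_part n ((1 - p) * series (\<lambda>n. p ^ n)) =
      p ^ n - (\<Sum>i\<le>n. deg_part i p * p ^ (n - i))"
    by (simp add: deg_part_diff left_diff_distrib deg_part_mult deg_part_series_homogeneous[OF hom])
  also have "(\<Sum>i\<le>n. deg_part i p * p ^ (n - i)) = (if n = 0 then 0 else p ^ n)"
  proof -
    have "(\<Sum>i\<le>n. deg_part i p * p ^ (n - i)) = (\<Sum>i\<le>n. if i = 1 then p * p ^ (n - 1) else 0)"
      by (intro sum.cong) (auto simp: homogeneous_deg_part[OF assms])
    then show ?thesis by (cases n) auto
  qed
  finally show "deg_part n ((1 - p) * series (\<lambda>n. p ^ n)) = deg_part n 1"
    by (simp add: homogeneous_deg_part[OF homogeneous_1])
qed

text \<open>By \<open>deg_part_log_deriv\<close>, the equations say degree by degree that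
  \<open>log_deriv t (x + psym 1)\<close> is p_1/(1 - p_1). The summand \<open>psym 1\<close>
  restores the linear term left out of the Lie series.\<close>

definition lie_like :: "nat \<Rightarrow> pser \<Rightarrow> bool" where
  "lie_like t x \<longleftrightarrow> vanish_below 1 x \<and> (\<forall>N\<ge>1. (\<Sum>k | k dvd N. (-1) ^ (t * (k - 1)) *
    power_subst k (of_nat (N div k) * deg_part (N div k) (x + psym 1))) = psym 1 ^ N)"

lemma series_plethysm_inverse:
  assumes a: "newton t psym a" and x: "lie_like t x" and van: "\<And>r. vanish_below r (a r)"
  shows "series (\<lambda>r. plethysm (a r) x) * (series a * (1 - psym 1)) = 1"
proof -
  define X where "X = series (\<lambda>r. plethysm (a r) x)"
  let ?p = "psym 1"
  let ?Z = "X * (series a * (1 - ?p))"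
  have x1: "vanish_below 1 x" using x by (simp add: lie_like_def)
  have hom: "homogeneous r (?p ^ r)" for r
    using homogeneous_power[OF homogeneous_sym(3)[of 1], of r] by simp
  have deg: "deg_part n (series (\<lambda>n. ?p ^ n)) = ?p ^ n" for n
    by (rule deg_part_series_homogeneous[OF hom])
  have "log_deriv t (x + ?p) = series (\<lambda>n. ?p ^ n) - 1"
  proof (rule deg_part_eqI)
    fix n show "deg_part n (log_deriv t (x + ?p)) = deg_part n (series (\<lambda>n. ?p ^ n) - 1)"
    proof (cases "n = 0")
      case True
      have "deg_part 0 (log_deriv t (x + ?p)) = 0"
        unfolding log_deriv_def by (subst deg_part_series[OF vanish_below_log_deriv]) simp
      with True show ?thesis
        unfolding deg_part_diff deg by (simp add: homogeneous_deg_part[OF homogeneous_1])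
    next
      case False
      with x have "deg_part n (log_deriv t (x + ?p)) = ?p ^ n"
        by (simp add: deg_part_log_deriv lie_like_def)
      with False show ?thesis
        unfolding deg_part_diff deg by (simp add: homogeneous_deg_part[OF homogeneous_1])
    qed
  qed
  then have "(log_deriv t x + log_deriv t ?p) * (1 - ?p) = (series (\<lambda>n. ?p ^ n) - 1) * (1 - ?p)"
    unfolding log_deriv_add by (rule arg_cong)
  also have "\<dots> = (1 - ?p) * series (\<lambda>n. ?p ^ n) - (1 - ?p)"
    by (simp add: algebra_simps)
  also have "\<dots> = ?p"
    unfolding geometric_series[OF homogeneous_sym(3)[of 1]] by simp
  finally have log: "(log_deriv t x + log_deriv t ?p) * (1 - ?p) = ?p" .
  have X: "euler X = log_deriv t x * X"
    unfolding X_def by (rule euler_series_plethysm[OF a x1])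
  have "vanish_below 1 ?p" by (intro homogeneous_vanish_below homogeneous_sym)
  \<comment> \<open>The case \<open>x = ?p\<close> of \<open>euler_series_plethysm\<close>, since
    a_r[p_1] = a_r.\<close>
  then have A: "euler (series a) = log_deriv t ?p * series a"
    using euler_series_plethysm[OF a, of ?p] by (simp add: plethysm_psym_1[OF a, simplified])
  have "euler ?p = ?p" using euler_homogeneous[OF homogeneous_sym(3)[of 1]] by simp
  \<comment> \<open>The last \<open>- ?p\<close> is the derivative of \<open>1 - ?p\<close>; by
    \<open>log\<close> the bracket is 0.\<close>
  then have "euler ?Z = X * series a * ((log_deriv t x + log_deriv t ?p) * (1 - ?p) - ?p)"
    by (simp add: euler_mult euler_diff X A algebra_simps)
  then have "?Z = const (coeff ?Z {#})"
    unfolding log by (intro euler_eq_0_imp_const) simp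
  also have "coeff ?Z {#} = 1"
  proof -
    have "coeff X {#} = coeff (plethysm (a 0) x) {#}"
      unfolding X_def by (subst coeff_series[OF vanish_below_plethysm[OF a x1], of _ 0]) auto
    also have "plethysm (a 0) x = 1"
      using newton_plethysm(1)[OF a, of x] by (simp add: newton_def)
    finally have "coeff X {#} = 1" by (simp add: coeff_1)
    moreover have "coeff (series a) {#} = 1"
      using a by (subst coeff_series[OF van, of _ 0]) (auto simp: newton_def coeff_1)
    ultimately show ?thesis by (simp add: coeff_mult_empty coeff_1 coeff_psym)
  qed
  finally show ?thesis unfolding X_def by simp
qed

text \<open>Let A be the series of the \<open>a r\<close>, so that X A (1 - p_1) = 1. The inverse of
  A is the signed series of the \<open>b r\<close> and that of 1 - p_1 is geometric, which expands
  X. The signed series of the b_r[x] is inverse to X, hence equal to A (1 - p_1).\<close>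

lemma plethysm_lie_like:
  assumes a: "newton t psym a" and b: "newton t' psym b" and ab: "dual a b"
    and hom: "\<And>r. homogeneous r (a r)" "\<And>r. homogeneous r (b r)"
    and x: "lie_like t x" and n: "n \<ge> 1"
  shows "(\<Sum>r=1..n. deg_part n (plethysm (a r) x)) = (\<Sum>k=0..n. (-1) ^ k * psym 1 ^ (n - k) * b k)"
    and "(\<Sum>r=1..n. (-1) ^ (r - 1) * deg_part n (plethysm (b r) x)) = psym 1 * a (n - 1) - a n"
proof -
  define X where "X = series (\<lambda>r. plethysm (a r) x)"
  define Y where "Y = series (\<lambda>r. (-1) ^ r * plethysm (b r) x)"
  let ?p = "psym 1"
  have x1: "vanish_below 1 x" using x by (simp add: lie_like_def)
  note van = hom[THEN homogeneous_vanish_below]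
  note van_pl = vanish_below_plethysm[OF _ x1]
  have inv: "X * (series a * (1 - ?p)) = 1"
    unfolding X_def by (rule series_plethysm_inverse[OF a x van(1)])
  have deg_1: "deg_part n 1 = 0"
    using n by (simp add: homogeneous_deg_part[OF homogeneous_1])
  have deg_p: "deg_part i (?p * f) = (if i = 0 then 0 else ?p * deg_part (i - 1) f)" for i f
  proof -
    have "deg_part i (?p * f) = (\<Sum>j\<le>i. if j = 1 then ?p * deg_part (i - 1) f else 0)"
      unfolding deg_part_mult
      by (intro sum.cong) (auto simp: homogeneous_deg_part[OF homogeneous_sym(3)])
    then show ?thesis by (cases i) auto
  qed
  \<comment> \<open>The term \<open>r = 0\<close> is 1 and has no component of degree
    \<open>n \<ge> 1\<close>, so the sums may start at 1.\<close>
  have range: "{..n} = insert 0 {1..n}" by auto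
  define B where "B = series (\<lambda>n. (-1) ^ n * b n)"
  define G where "G = series (\<lambda>n. ?p ^ n)"
  have "B * series a = 1"
    unfolding B_def by (rule series_dual[OF dual_sym[OF ab] van(2,1)])
  moreover have "(1 - ?p) * G = 1"
    unfolding G_def by (rule geometric_series[OF homogeneous_sym(3)])
  ultimately have "X = X * (B * series a) * ((1 - ?p) * G)" by simp
  also have "\<dots> = X * (series a * (1 - ?p)) * (B * G)" by (simp add: mult_ac)
  finally have "X = B * G" using inv by simp
  have hom_B: "homogeneous r ((-1) ^ r * b r)" for r
    using hom(2)[of r] by (auto simp: homogeneous_def)
  have hom_G: "homogeneous r (?p ^ r)" for r
    using homogeneous_power[OF homogeneous_sym(3)[of 1], of r] by simp
  have "(\<Sum>r=1..n. deg_part n (plethysm (a r) x)) = deg_part n X"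
    unfolding X_def deg_part_series[OF van_pl[OF a]] range
    using newton_plethysm(1)[OF a, of x] by (simp add: newton_def deg_1)
  also have "\<dots> = (\<Sum>k\<le>n. (-1) ^ k * b k * ?p ^ (n - k))"
    unfolding \<open>X = B * G\<close> deg_part_mult B_def G_def
      deg_part_series_homogeneous[OF hom_B] deg_part_series_homogeneous[OF hom_G] ..
  finally show "(\<Sum>r=1..n. deg_part n (plethysm (a r) x)) = (\<Sum>k=0..n. (-1) ^ k * ?p ^ (n - k) * b k)"
    by (simp add: atLeast0AtMost mult_ac)
  have "Y * X = 1"
    unfolding Y_def X_def
    by (rule series_dual[OF dual_plethysm[OF b a dual_sym[OF ab]] van_pl[OF b] van_pl[OF a]])
  have "Y = Y * (X * (series a * (1 - ?p)))" using inv by simp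
  also have "\<dots> = (Y * X) * (series a * (1 - ?p))" by (simp add: mult_ac)
  also have "\<dots> = series a - ?p * series a"
    unfolding \<open>Y * X = 1\<close> by (simp add: algebra_simps)
  finally have Y: "Y = series a - ?p * series a" .
  have "(\<Sum>r=1..n. (-1) ^ (r - 1) * deg_part n (plethysm (b r) x)) =
      - (\<Sum>r=1..n. deg_part n ((-1) ^ r * plethysm (b r) x))"
    unfolding sum_negf[symmetric]
    by (rule sum.cong) (auto simp: deg_part_uminus minus_one_power_iff)
  also have "\<dots> = - deg_part n Y"
    unfolding Y_def deg_part_series[OF vanish_below_signed[OF van_pl[OF b]]] range
    using newton_plethysm(1)[OF b, of x] by (simp add: newton_def deg_1)
  also have "\<dots> = ?p * a (n - 1) - a n"
    using n by (simp only: Y deg_part_diff deg_p deg_part_series_homogeneous[OF hom(1)]) simp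
  finally show "(\<Sum>r=1..n. (-1) ^ (r - 1) * deg_part n (plethysm (b r) x)) = \<dots>" .
qed

section \<open>Characters induced from the cyclic group\<close>

lemma orbit_conj:
  assumes "bij \<tau>"
  shows "orbit (\<tau> \<circ> \<rho> \<circ> inv \<tau>) (\<tau> x) = \<tau> ` orbit \<rho> x"
proof -
  have inv: "inv \<tau> (\<tau> y) = y" for y
    using assms by (simp add: bij_is_inj)
  have "((\<tau> \<circ> \<rho> \<circ> inv \<tau>) ^^ m) (\<tau> x) = \<tau> ((\<rho> ^^ m) x)" for m
    by (induction m) (auto simp: inv)
  then show ?thesis unfolding orbit_altdef by auto
qed

lemma cycle_type_conj:
  assumes "\<tau> permutes {..<n}"
  shows "cycle_type n (\<tau> \<circ> \<rho> \<circ> inv \<tau>) = cycle_type n \<rho>"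
proof -
  have bij: "bij \<tau>" using assms by (rule permutes_bij)
  then have inj: "inj \<tau>" by (rule bij_is_inj)
  have "orbit (\<tau> \<circ> \<rho> \<circ> inv \<tau>) ` {..<n} = orbit (\<tau> \<circ> \<rho> \<circ> inv \<tau>) ` \<tau> ` {..<n}"
    using permutes_image[OF assms] by simp
  also have "\<dots> = image \<tau> ` orbit \<rho> ` {..<n}"
    by (simp only: image_image orbit_conj[OF bij])
  finally have "cycle_type n (\<tau> \<circ> \<rho> \<circ> inv \<tau>) =
      image_mset card (mset_set (image \<tau> ` orbit \<rho> ` {..<n}))"
    by (simp add: cycle_type_def)
  also have "mset_set (image \<tau> ` orbit \<rho> ` {..<n}) =
      image_mset (image \<tau>) (mset_set (orbit \<rho> ` {..<n}))"
    by (rule image_mset_mset_set[symmetric])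
      (metis inj inj_image_eq_iff inj_onI)
  also have "image_mset card \<dots> = cycle_type n \<rho>"
    using inj by (simp add: cycle_type_def multiset.map_comp comp_def card_image inj_on_subset)
  finally show ?thesis .
qed

text \<open>The right-hand side is the cycle index of \<open>H\<close> weighted by
  \<open>\<psi>\<close>. Conjugation by \<open>\<tau>\<close> preserves cycle types, so each of the
  n! permutations \<open>\<tau>\<close> in the definition of the induced character contributes the
  same sum \<open>Q\<close>.\<close>

lemma frob_char_induced:
  assumes H: "H \<subseteq> {\<sigma>. \<sigma> permutes {..<n}}" and "H \<noteq> {}"
  shows "of_nat (card H) * frob_char n (induced_char n H \<psi>) =
    (\<Sum>\<rho>\<in>H. const (\<psi> \<rho>) * (\<Prod>i\<in>#cycle_type n \<rho>. psym i))"
proof -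
  define S where "S = {\<sigma>. \<sigma> permutes {..<n}}"
  define P where "P = (\<lambda>\<sigma>. \<Prod>i\<in>#cycle_type n \<sigma>. psym i)"
  define Q where "Q = (\<Sum>\<rho>\<in>H. const (\<psi> \<rho>) * P \<rho>)"
  have S: "finite S" "card S = fact n"
    by (simp_all add: S_def finite_permutations card_permutations)
  have "finite H" using H S(1) finite_subset by (auto simp: S_def)
  have card_H: "card H \<noteq> 0" using \<open>finite H\<close> \<open>H \<noteq> {}\<close> by simp
  have ind: "const (induced_char n H \<psi> \<sigma>) = const (1 / of_nat (card H)) *
      (\<Sum>\<tau>\<in>S. if inv \<tau> \<circ> \<sigma> \<circ> \<tau> \<in> H then const (\<psi> (inv \<tau> \<circ> \<sigma> \<circ> \<tau>)) else 0)" for \<sigma>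
  proof -
    have "(\<Sum>\<tau> | \<tau> permutes {..<n} \<and> inv \<tau> \<circ> \<sigma> \<circ> \<tau> \<in> H. \<psi> (inv \<tau> \<circ> \<sigma> \<circ> \<tau>)) =
        (\<Sum>\<tau>\<in>S. if inv \<tau> \<circ> \<sigma> \<circ> \<tau> \<in> H then \<psi> (inv \<tau> \<circ> \<sigma> \<circ> \<tau>) else 0)"
      by (rule sum.mono_neutral_cong_left) (auto simp: S_def finite_permutations)
    then show ?thesis
      unfolding induced_char_def const_mult by (simp add: const_sum if_distrib[of const] cong: if_cong)
  qed
  have conj: "(\<Sum>\<sigma>\<in>S. (if inv \<tau> \<circ> \<sigma> \<circ> \<tau> \<in> H then const (\<psi> (inv \<tau> \<circ> \<sigma> \<circ> \<tau>)) else 0) * P \<sigma>) = Q"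
    if "\<tau> \<in> S" for \<tau>
  proof -
    have \<tau>: "\<tau> permutes {..<n}" using that by (simp add: S_def)
    note bij = permutes_bij[OF \<tau>]
    have inv1: "inv \<tau> \<circ> \<tau> = id" and inv2: "\<tau> \<circ> inv \<tau> = id"
      using \<tau> by (auto simp: permutes_inv_o)
    have c1: "inv \<tau> \<circ> (\<tau> \<circ> \<rho> \<circ> inv \<tau>) \<circ> \<tau> = \<rho>" for \<rho>
      by (metis comp_assoc inv1 comp_id id_comp)
    have c2: "\<tau> \<circ> (inv \<tau> \<circ> \<rho> \<circ> \<tau>) \<circ> inv \<tau> = \<rho>" for \<rho>
      by (metis comp_assoc inv2 comp_id id_comp)
    have "(\<Sum>\<sigma>\<in>S. (if inv \<tau> \<circ> \<sigma> \<circ> \<tau> \<in> H then const (\<psi> (inv \<tau> \<circ> \<sigma> \<circ> \<tau>)) else 0) * P \<sigma>) =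
        (\<Sum>\<rho>\<in>S. (if \<rho> \<in> H then const (\<psi> \<rho>) else 0) * P \<rho>)"
    proof (rule sum.reindex_bij_witness[where i = "\<lambda>\<rho>. \<tau> \<circ> \<rho> \<circ> inv \<tau>" and j = "\<lambda>\<sigma>. inv \<tau> \<circ> \<sigma> \<circ> \<tau>"])
      fix \<sigma> assume "\<sigma> \<in> S"
      then show "inv \<tau> \<circ> \<sigma> \<circ> \<tau> \<in> S" "\<tau> \<circ> \<sigma> \<circ> inv \<tau> \<in> S"
        using \<tau> by (auto simp: S_def intro!: permutes_compose permutes_inv)
      have "P (inv \<tau> \<circ> \<sigma> \<circ> \<tau>) = P \<sigma>"
        unfolding P_def by (metis c2 cycle_type_conj[OF \<tau>])
      then show "(if inv \<tau> \<circ> \<sigma> \<circ> \<tau> \<in> H then const (\<psi> (inv \<tau> \<circ> \<sigma> \<circ> \<tau>)) else 0) * P (inv \<tau> \<circ> \<sigma> \<circ> \<tau>) =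
          (if inv \<tau> \<circ> \<sigma> \<circ> \<tau> \<in> H then const (\<psi> (inv \<tau> \<circ> \<sigma> \<circ> \<tau>)) else 0) * P \<sigma>"
        by simp
    qed (simp_all add: c1 c2)
    also have "\<dots> = Q"
      unfolding Q_def using H S(1) by (intro sum.mono_neutral_cong_right) (auto simp: S_def)
    finally show ?thesis .
  qed
  have "frob_char n (induced_char n H \<psi>) =
      const (1 / fact n) * (\<Sum>\<sigma>\<in>S. const (induced_char n H \<psi> \<sigma>) * P \<sigma>)"
    by (simp add: frob_char_def S_def P_def)
  also have "(\<Sum>\<sigma>\<in>S. const (induced_char n H \<psi> \<sigma>) * P \<sigma>) = const (1 / of_nat (card H)) *
      (\<Sum>\<sigma>\<in>S. \<Sum>\<tau>\<in>S. (if inv \<tau> \<circ> \<sigma> \<circ> \<tau> \<in> H then const (\<psi> (inv \<tau> \<circ> \<sigma> \<circ> \<tau>)) else 0) * P \<sigma>)"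
    by (simp only: ind sum_distrib_left sum_distrib_right mult.assoc)
  also have "(\<Sum>\<sigma>\<in>S. \<Sum>\<tau>\<in>S. (if inv \<tau> \<circ> \<sigma> \<circ> \<tau> \<in> H then const (\<psi> (inv \<tau> \<circ> \<sigma> \<circ> \<tau>)) else 0) * P \<sigma>) =
      (\<Sum>\<tau>\<in>S. Q)"
    by (subst sum.swap, rule sum.cong[OF refl]) (rule conj)
  also have "(\<Sum>\<tau>\<in>S. Q) = of_nat (fact n) * Q"
    by (simp add: S(2))
  also have "const (1 / fact n) * (const (1 / of_nat (card H)) * (of_nat (fact n) * Q)) =
      const (1 / fact n * (1 / of_nat (card H)) * of_nat (fact n)) * Q"
    by (simp only: const_mult const_of_nat mult.assoc)
  also have "1 / fact n * (1 / of_nat (card H)) * of_nat (fact n) = (1 / of_nat (card H) :: complex)"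
    by simp
  finally have "of_nat (card H) * frob_char n (induced_char n H \<psi>) =
      const (of_nat (card H) * (1 / of_nat (card H))) * Q"
    by (simp only: const_mult const_of_nat mult.assoc)
  also have "of_nat (card H) * (1 / of_nat (card H)) = (1 :: complex)" using card_H by simp
  finally show ?thesis by (simp add: Q_def P_def)
qed

section \<open>Powers of the long cycle and their cycle types\<close>

lemma funpow_long_cycle:
  "(long_cycle n ^^ k) i = (if i < n then (i + k) mod n else i)"
proof (induction k)
  case (Suc k)
  then show ?case
    by (auto simp: long_cycle_def mod_Suc_eq)
qed auto

lemma long_cycle_permutes: "long_cycle n permutes {..<n}"
proof (rule bij_imp_permutes)
  have "inj_on (long_cycle n) {..<n}"
  proof (rule inj_onI)
    \<comment> \<open>Applying the cycle \<open>n - 1\<close> more times undoes one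
      application.\<close>
    fix i j assume ij: "i \<in> {..<n}" "j \<in> {..<n}" "long_cycle n i = long_cycle n j"
    have unwind: "(long_cycle n ^^ (n - 1)) (long_cycle n k) = k" if "k < n" for k
    proof -
      have "(long_cycle n ^^ (n - 1)) (long_cycle n k) = (long_cycle n ^^ n) k"
        using that by (metis Suc_diff_1 funpow_swap1 funpow_simps_right(2) less_nat_zero_code
            comp_apply not_gr_zero)
      with that show ?thesis by (simp add: funpow_long_cycle)
    qed
    then show "i = j" using ij by (metis unwind lessThan_iff)
  qed
  moreover have "long_cycle n ` {..<n} \<subseteq> {..<n}" by (auto simp: long_cycle_def)
  ultimately show "bij_betw (long_cycle n) {..<n} {..<n}"
    by (simp add: bij_betw_def endo_inj_surj)
qed (auto simp: long_cycle_def)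

lemma cyclic_subgroup_eq:
  assumes "n \<ge> 1"
  shows "cyclic_subgroup n = (\<lambda>k. long_cycle n ^^ k) ` {..<n}"
proof -
  have "long_cycle n ^^ k = long_cycle n ^^ (k mod n)" for k
    by (rule ext) (simp add: funpow_long_cycle mod_add_right_eq)
  then show ?thesis
    using assms unfolding cyclic_subgroup_def
    by (auto simp: image_iff) (metis lessThan_iff mod_less_divisor Suc_le_eq)
qed

lemma funpow_long_cycle_eqD:
  assumes "long_cycle n ^^ k = long_cycle n ^^ j" "j < n"
  shows "k mod n = j"
  using fun_cong[OF assms(1), of 0] assms(2) by (auto simp: funpow_long_cycle)

lemma inj_on_funpow_long_cycle: "inj_on (\<lambda>k. long_cycle n ^^ k) {..<n}"
  by (rule inj_onI) (metis funpow_long_cycle_eqD lessThan_iff mod_less)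

lemma cyclic_char_funpow:
  assumes "j < n"
  shows "cyclic_char n z (long_cycle n ^^ j) = z ^ j"
proof -
  have "(LEAST k. long_cycle n ^^ k = long_cycle n ^^ j) = j"
    by (rule Least_equality) (use assms funpow_long_cycle_eqD in \<open>auto intro: mod_less_eq_dividend\<close>)
  then show ?thesis by (simp add: cyclic_char_def)
qed

text \<open>Modulo \<open>n\<close>, the multiples of \<open>k\<close> are the multiples of
  \<open>gcd k n\<close>, so rotation by \<open>k\<close> has residue classes as orbits.\<close>

lemma orbit_funpow_long_cycle:
  assumes "i < n"
  shows "orbit (long_cycle n ^^ k) i = {x. x < n \<and> x mod gcd k n = i mod gcd k n}"
proof -
  have orbit: "orbit (long_cycle n ^^ k) i = {(i + k * m) mod n | m. m > 0}"
    unfolding orbit_altdef using assms by (auto simp: funpow_long_cycle funpow_mult)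
  show ?thesis
  proof (intro equalityI subsetI)
    fix x assume "x \<in> orbit (long_cycle n ^^ k) i"
    then obtain m where x: "x = (i + k * m) mod n" unfolding orbit by auto
    have "x mod gcd k n = (i + k * m) mod gcd k n"
      unfolding x by (simp add: mod_mod_cancel)
    also have "\<dots> = i mod gcd k n"
      by (metis dvd_mult2 gcd_dvd1 mod_add_right_eq add.right_neutral dvd_imp_mod_0)
    finally show "x \<in> {x. x < n \<and> x mod gcd k n = i mod gcd k n}"
      using x assms by simp
  next
    fix x assume "x \<in> {x. x < n \<and> x mod gcd k n = i mod gcd k n}"
    then have x: "x < n" "x mod gcd k n = i mod gcd k n" by auto
    \<comment> \<open>Adding \<open>n\<close> keeps the difference with \<open>i\<close> from being
      truncated.\<close>
    have "[x + n = i] (mod gcd k n)"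
      using cong_add[of x i "gcd k n" n 0] x(2) by (simp add: cong_def)
    then have "gcd k n dvd x + n - i"
      using assms by (simp add: cong_altdef_nat)
    then obtain q where "x + n - i = gcd k n * q" by blast
    with assms have q: "x + n = i + gcd k n * q" by simp
    obtain m where m: "[k * m = gcd k n] (mod n)" using cong_solve_nat by blast
    have "[k * n = 0] (mod n)" by (simp add: cong_def)
    \<comment> \<open>The extra \<open>k * n\<close> is 0 modulo \<open>n\<close> but makes the
      exponent \<open>m * q + n\<close> positive, as membership in \<open>orbit\<close>
      demands.\<close>
    then have "[i + (k * m * q + k * n) = i + (gcd k n * q + 0)] (mod n)"
      by (intro cong_add cong_mult m cong_refl)
    then have "[i + k * (m * q + n) = i + gcd k n * q] (mod n)"
      by (simp only: distrib_left mult.assoc add_0_right)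
    then have "(i + k * (m * q + n)) mod n = x"
      unfolding q[symmetric] using x(1) by (simp add: cong_def)
    moreover have "m * q + n > 0" using assms by simp
    ultimately show "x \<in> orbit (long_cycle n ^^ k) i" unfolding orbit by blast
  qed
qed

lemma card_residue_class:
  assumes "g dvd n" "r < g"
  shows "card {x. x < n \<and> x mod g = r} = n div g"
proof -
  obtain d where n: "n = g * d" using assms(1) by blast
  have "bij_betw (\<lambda>q. r + g * q) {..<d} {x. x < n \<and> x mod g = r}"
  proof (rule bij_betw_byWitness[where f' = "\<lambda>x. x div g"])
    show "(\<lambda>q. r + g * q) ` {..<d} \<subseteq> {x. x < n \<and> x mod g = r}"
    proof safe
      fix q assume "q < d"
      then have "g * Suc q \<le> g * d" by (intro mult_le_mono2) simp
      then show "r + g * q < n" using assms(2) by (simp add: n)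
      show "(r + g * q) mod g = r" using assms(2) by simp
    qed
    show "(\<lambda>x. x div g) ` {x. x < n \<and> x mod g = r} \<subseteq> {..<d}"
      by (auto simp: n less_mult_imp_div_less mult.commute)
    show "\<forall>x\<in>{x. x < n \<and> x mod g = r}. r + g * (x div g) = x"
      by auto
  qed (use assms(2) in auto)
  then show ?thesis
    using assms(2) by (simp add: n bij_betw_same_card[symmetric])
qed

lemma cycle_type_funpow_long_cycle:
  assumes "n \<ge> 1"
  shows "cycle_type n (long_cycle n ^^ k) = replicate_mset (gcd k n) (n div gcd k n)"
proof -
  define g where "g = gcd k n"
  define A where "A = (\<lambda>r. {x. x < n \<and> x mod g = r})"
  have g: "g > 0" "g dvd n" "g \<le> n" using assms by (auto simp: g_def intro!: dvd_imp_le)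
  have "orbit (long_cycle n ^^ k) ` {..<n} = (\<lambda>i. A (i mod g)) ` {..<n}"
    by (rule image_cong) (auto simp: orbit_funpow_long_cycle A_def g_def)
  also have "\<dots> = A ` {..<g}"
  proof (intro equalityI subsetI)
    fix X assume "X \<in> A ` {..<g}"
    then obtain r where "r < g" "X = A r" by auto
    with g show "X \<in> (\<lambda>i. A (i mod g)) ` {..<n}" by (intro image_eqI[of _ _ r]) auto
  qed (use g in auto)
  finally have "cycle_type n (long_cycle n ^^ k) = image_mset card (mset_set (A ` {..<g}))"
    unfolding cycle_type_def by (simp only:)
  also have "mset_set (A ` {..<g}) = image_mset A (mset_set {..<g})"
  proof (rule image_mset_mset_set[symmetric], rule inj_onI)
    fix r s
    assume rs: "r \<in> {..<g}" "s \<in> {..<g}" "A r = A s"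
    from rs(1) g(3) have "r \<in> A r" by (simp add: A_def)
    then have "r \<in> A s" unfolding rs(3) .
    with rs(1) show "r = s" by (simp add: A_def)
  qed
  also have "image_mset card \<dots> = image_mset (\<lambda>_. n div g) (mset_set {..<g})"
    by (auto simp: multiset.map_comp A_def card_residue_class[OF g(2)] intro!: image_mset_cong)
  also have "\<dots> = replicate_mset g (n div g)"
    by (simp add: image_mset_const_eq)
  finally show ?thesis by (simp add: g_def)
qed

lemma frob_char_cyclic:
  assumes "n \<ge> 1"
  shows "of_nat n * frob_char n (induced_char n (cyclic_subgroup n) (cyclic_char n z)) =
    (\<Sum>k<n. const (z ^ k) * psym (n div gcd k n) ^ gcd k n)"
proof -
  have "of_nat (card (cyclic_subgroup n)) *
      frob_char n (induced_char n (cyclic_subgroup n) (cyclic_char n z)) =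
      (\<Sum>\<rho>\<in>cyclic_subgroup n. const (cyclic_char n z \<rho>) * (\<Prod>i\<in>#cycle_type n \<rho>. psym i))"
  proof (rule frob_char_induced)
    show "cyclic_subgroup n \<subseteq> {\<sigma>. \<sigma> permutes {..<n}}"
    proof -
      have "long_cycle n ^^ k permutes {..<n}" for k
      proof (induction k)
        case 0
        show ?case unfolding funpow_0 funpow.simps(1) by (rule permutes_id)
      next
        case (Suc k)
        then show ?case
          unfolding funpow.simps(2) by (rule permutes_compose[OF _ long_cycle_permutes])
      qed
      then show ?thesis by (auto simp: cyclic_subgroup_def)
    qed
  qed (simp add: cyclic_subgroup_def)
  also have "card (cyclic_subgroup n) = n"
    using assms by (simp add: cyclic_subgroup_eq card_image inj_on_funpow_long_cycle)
  also have "(\<Sum>\<rho>\<in>cyclic_subgroup n. const (cyclic_char n z \<rho>) * (\<Prod>i\<in>#cycle_type n \<rho>. psym i)) =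
      (\<Sum>k<n. const (z ^ k) * psym (n div gcd k n) ^ gcd k n)"
    unfolding cyclic_subgroup_eq[OF assms] sum.reindex[OF inj_on_funpow_long_cycle]
    by (rule sum.cong) (auto simp: cyclic_char_funpow cycle_type_funpow_long_cycle[OF assms])
  finally show ?thesis .
qed

section \<open>Sums over primitive roots of unity\<close>

text \<open>The numerator \<open>q\<close> is a parameter: \<open>q = 1\<close> belongs to
  \<open>Lie n\<close>, the 2-part of \<open>n\<close> to \<open>Lie2 n\<close>.\<close>

definition root_unity :: "nat \<Rightarrow> nat \<Rightarrow> complex" where
  "root_unity q n = exp (2 * of_real pi * \<i> * of_nat q / of_nat n)"

text \<open>Ramanujan's sum \<open>c\<^sub>d(q)\<close>.\<close>

definition root_sum :: "nat \<Rightarrow> nat \<Rightarrow> complex" where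
  "root_sum q d = (\<Sum>j | j < d \<and> coprime j d. root_unity q d ^ j)"

lemma root_unity_power_mult:
  assumes "g \<ge> 1"
  shows "root_unity q (g * d) ^ (g * j) = root_unity q d ^ j"
  using assms by (simp add: root_unity_def mult.assoc flip: exp_of_nat_mult)

text \<open>Each fraction k/n with \<open>k < n\<close> is written in lowest terms j/d;
  \<open>k = 0\<close> becomes 0/1.\<close>

lemma sum_by_gcd:
  fixes G :: "nat \<Rightarrow> nat \<Rightarrow> 'a :: comm_monoid_add"
  assumes "n \<ge> 1"
  shows "(\<Sum>k<n. G (n div gcd k n) (k div gcd k n)) = (\<Sum>d | d dvd n. \<Sum>j | j < d \<and> coprime j d. G d j)"
proof -
  have "finite {d. d dvd n}" using assms by auto
  then have "(\<Sum>d | d dvd n. \<Sum>j | j < d \<and> coprime j d. G d j) =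
      (\<Sum>(d, j) \<in> (SIGMA d : {d. d dvd n}. {j. j < d \<and> coprime j d}). G d j)"
    by (subst sum.Sigma) auto
  also have "\<dots> = (\<Sum>k<n. G (n div gcd k n) (k div gcd k n))"
  proof (rule sum.reindex_bij_witness[symmetric, where i = "\<lambda>(d, j). j * (n div d)"
        and j = "\<lambda>k. (n div gcd k n, k div gcd k n)"])
    fix k assume k: "k \<in> {..<n}"
    have g: "gcd k n > 0" using assms by simp
    have eq: "gcd k n * (n div gcd k n) = n" "gcd k n * (k div gcd k n) = k" by simp_all
    have "k div gcd k n < n div gcd k n"
      using k g eq by (metis lessThan_iff mult_less_cancel1)
    moreover have "coprime (k div gcd k n) (n div gcd k n)"
      using assms by (intro div_gcd_coprime) auto
    ultimately show "(n div gcd k n, k div gcd k n) \<in> (SIGMA d : {d. d dvd n}. {j. j < d \<and> coprime j d})"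
      using dvd_triv_right[of "n div gcd k n" "gcd k n"] by (auto simp: eq(1))
    have "n div (n div gcd k n) = gcd k n"
      using assms by (simp add: div_div_eq_right)
    then show "(case (n div gcd k n, k div gcd k n) of (d, j) \<Rightarrow> j * (n div d)) = k" by simp
  next
    fix x assume "x \<in> (SIGMA d : {d. d dvd n}. {j. j < d \<and> coprime j d})"
    then obtain d j where x: "x = (d, j)" "d dvd n" "j < d" "coprime j d" by auto
    from x(2) obtain e where n: "n = d * e" by blast
    have "d > 0" "e > 0" using assms n by auto
    then have e: "n div d = e" "n div e = d" by (simp_all add: n)
    have "gcd j d = 1" using x(4) by simp
    then have "gcd (j * e) (d * e) = e"
      by (metis gcd_mult_distrib_nat mult.commute mult_1_right)
    with x n e \<open>d > 0\<close> \<open>e > 0\<close>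
    show "(case x of (d, j) \<Rightarrow> j * (n div d)) \<in> {..<n}"
      "(n div gcd (case x of (d, j) \<Rightarrow> j * (n div d)) n,
        (case x of (d, j) \<Rightarrow> j * (n div d)) div gcd (case x of (d, j) \<Rightarrow> j * (n div d)) n) = x"
      by simp_all
  qed auto
  finally show ?thesis ..
qed

text \<open>\<open>root_unity q n ^ k\<close> depends only on \<open>q\<close> and the fraction k/n,
  so terms with the same reduced denominator collect into a Ramanujan sum.\<close>

lemma sum_root_sum:
  fixes G :: "nat \<Rightarrow> pser"
  assumes "n \<ge> 1"
  shows "(\<Sum>k<n. const (root_unity q n ^ k) * G (n div gcd k n)) =
    (\<Sum>d | d dvd n. const (root_sum q d) * G d)"
proof -
  have "(\<Sum>k<n. const (root_unity q n ^ k) * G (n div gcd k n)) =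
      (\<Sum>k<n. const (root_unity q (n div gcd k n) ^ (k div gcd k n)) * G (n div gcd k n))"
  proof (rule sum.cong[OF refl])
    fix k
    have "gcd k n \<ge> 1" using assms by (simp add: Suc_le_eq)
    from root_unity_power_mult[OF this, of q "n div gcd k n" "k div gcd k n"]
    show "const (root_unity q n ^ k) * G (n div gcd k n) =
        const (root_unity q (n div gcd k n) ^ (k div gcd k n)) * G (n div gcd k n)" by simp
  qed
  also have "\<dots> = (\<Sum>d | d dvd n. \<Sum>j | j < d \<and> coprime j d. const (root_unity q d ^ j) * G d)"
    by (rule sum_by_gcd[OF assms])
  finally show ?thesis by (simp add: root_sum_def const_sum sum_distrib_right)
qed

text \<open>The case \<open>G = 1\<close> of \<open>sum_root_sum\<close>: a geometric sum over the
  powers of \<open>root_unity q n\<close>, an \<open>n\<close>-th root of unity that is 1 exactly if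
  \<open>n dvd q\<close>.\<close>

lemma sum_root_sum_divisors:
  assumes "n \<ge> 1"
  shows "(\<Sum>d | d dvd n. root_sum q d) = (if n dvd q then of_nat n else 0)"
proof -
  have "const (\<Sum>d | d dvd n. root_sum q d) = const (\<Sum>k<n. root_unity q n ^ k)"
    using sum_root_sum[OF assms, of q "\<lambda>_. 1"] by (simp add: const_sum)
  then have "(\<Sum>d | d dvd n. root_sum q d) = (\<Sum>k<n. root_unity q n ^ k)"
    by (metis coeff_const)
  also have "\<dots> = (if n dvd q then of_nat n else 0)"
  proof (cases "n dvd q")
    case True
    then have "root_unity q n = 1"
      using assms complex_root_unity_eq_1[of n q] by (simp add: root_unity_def)
    with True show ?thesis by simp
  next
    case False
    then have "root_unity q n \<noteq> 1"
      using assms complex_root_unity_eq_1[of n q] by (simp add: root_unity_def)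
    moreover have "\<exists>m :: int. real q = of_int m" by (rule exI[of _ "int q"]) simp
    then have "root_unity q n ^ n = 1"
      using assms root_unity_power_mult[of n q 1 1] by (simp add: root_unity_def exp_eq_1)
    ultimately show ?thesis
      using False geometric_sum[of "root_unity q n" n] by simp
  qed
  finally show ?thesis .
qed

text \<open>Using the 2-part of \<open>d\<close> itself makes the coefficient of p_d^(n/d) in
  \<open>n\<close> times \<open>Lie2 n\<close> independent of \<open>n\<close>;
  \<open>root_sum_power_2\<close> justifies this.\<close>

definition root_sum2 :: "nat \<Rightarrow> complex" where
  "root_sum2 d = root_sum (2 ^ multiplicity 2 d) d"

lemma dvd_power_2_iff:
  assumes "n \<ge> 1" "multiplicity 2 n \<le> w"
  shows "n dvd 2 ^ w \<longleftrightarrow> n = 2 ^ multiplicity 2 (n :: nat)"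
proof
  assume "n dvd 2 ^ w"
  then obtain i where "n = 2 ^ i" using divides_primepow_nat[of 2 n w] by auto
  then show "n = 2 ^ multiplicity 2 n" by simp
next
  assume "n = 2 ^ multiplicity 2 n"
  with assms(2) show "n dvd 2 ^ w" by (metis le_imp_power_dvd)
qed

lemma multiplicity_mono: "d dvd n \<Longrightarrow> n \<ge> 1 \<Longrightarrow> multiplicity 2 d \<le> multiplicity 2 (n :: nat)"
  by (rule dvd_imp_multiplicity_le) auto

text \<open>The divisor sums determine \<open>root_sum\<close> recursively, and for powers of two \<open>q\<close> divisible by
  the \<open>2\<close>-part of \<open>d\<close> they do not depend on \<open>q\<close>.\<close>

lemma root_sum_power_2:
  assumes "d \<ge> 1" "multiplicity 2 d \<le> w"
  shows "root_sum (2 ^ w) d = root_sum2 d"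
  using assms
proof (induction d arbitrary: w rule: less_induct)
  case (less d)
  have split: "root_sum q d = (if d dvd q then of_nat d else 0) - (\<Sum>e | e dvd d \<and> e \<noteq> d. root_sum q e)"
    for q
  proof -
    have "{e. e dvd d} = insert d {e. e dvd d \<and> e \<noteq> d}" by auto
    moreover have "finite {e. e dvd d \<and> e \<noteq> d}" using less.prems(1) by simp
    ultimately have "(\<Sum>e | e dvd d. root_sum q e) = root_sum q d + (\<Sum>e | e dvd d \<and> e \<noteq> d. root_sum q e)"
      by (metis (mono_tags, lifting) mem_Collect_eq sum.insert)
    then show ?thesis
      using sum_root_sum_divisors[OF less.prems(1), of q] by simp
  qed
  have "root_sum (2 ^ w) e = root_sum (2 ^ multiplicity 2 d) e" if e: "e dvd d" "e \<noteq> d" for e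
  proof -
    have "e < d" "e \<ge> 1" using e less.prems(1) by (auto simp: Suc_le_eq intro: dvd_pos_nat dest: dvd_imp_le)
    then show ?thesis
      using less.IH[of e] multiplicity_mono[OF e(1) less.prems(1)] less.prems(2) by simp
  qed
  moreover have "d dvd 2 ^ w \<longleftrightarrow> d dvd 2 ^ multiplicity 2 d"
    using dvd_power_2_iff[OF less.prems] dvd_power_2_iff[OF less.prems(1) order_refl] by simp
  ultimately show ?case
    unfolding root_sum2_def split[of "2 ^ w"] split[of "2 ^ multiplicity 2 d"]
    by (auto intro: sum.cong)
qed

text \<open>All summands may use the same numerator, the 2-part of \<open>n\<close>, which
  \<open>n\<close> divides only if \<open>n\<close> is a power of two.\<close>

lemma sum_root_sum2_divisors:
  assumes "n \<ge> 1"
  shows "(\<Sum>d | d dvd n. root_sum2 d) = (if n = 2 ^ multiplicity 2 n then of_nat n else 0)"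
proof -
  have "(\<Sum>d | d dvd n. root_sum2 d) = (\<Sum>d | d dvd n. root_sum (2 ^ multiplicity 2 n) d)"
    using assms
    by (intro sum.cong root_sum_power_2[symmetric] multiplicity_mono refl)
      (auto simp: Suc_le_eq intro: dvd_pos_nat)
  also have "\<dots> = (if n dvd 2 ^ multiplicity 2 n then of_nat n else 0)"
    by (rule sum_root_sum_divisors[OF assms])
  finally show ?thesis using dvd_power_2_iff[OF assms order_refl] by simp
qed

text \<open>For even \<open>n\<close> the divisors with even cofactor are those of \<open>n div 2\<close>, and the two
  unsigned sums cancel.\<close>

lemma signed_sum_root_sum2_divisors:
  assumes "n \<ge> 1"
  shows "(\<Sum>d | d dvd n. (-1) ^ (n div d - 1) * root_sum2 d) = (if n = 1 then 1 else 0)"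
proof (cases "even n")
  case False
  have "(\<Sum>d | d dvd n. (-1) ^ (n div d - 1) * root_sum2 d) = (\<Sum>d | d dvd n. root_sum2 d)"
  proof (rule sum.cong[OF refl])
    fix d assume "d \<in> {d. d dvd n}"
    then have "n = d * (n div d)" by simp
    with False have "odd (n div d)" by (metis even_mult_iff)
    then show "(-1) ^ (n div d - 1) * root_sum2 d = root_sum2 d" by simp
  qed
  moreover have "n = 2 ^ multiplicity 2 n \<longleftrightarrow> n = 1"
    using False by (simp add: not_dvd_imp_multiplicity_0)
  ultimately show ?thesis by (simp add: sum_root_sum2_divisors[OF assms])
next
  case True
  then obtain m where n: "n = 2 * m" by blast
  with assms have m: "m \<ge> 1" by simp
  have fin: "finite {d. d dvd n}" using assms by auto
  have sub: "{d. d dvd m} \<subseteq> {d. d dvd n}" by (auto simp: n)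
  have "(\<Sum>d | d dvd n. (-1) ^ (n div d - 1) * root_sum2 d) =
      (\<Sum>d | d dvd n. root_sum2 d - (if d dvd m then 2 * root_sum2 d else 0))"
  proof (rule sum.cong[OF refl])
    fix d assume "d \<in> {d. d dvd n}"
    then obtain e where e: "n = d * e" by auto
    with assms have "d > 0" "e > 0" by auto
    have "d dvd m \<longleftrightarrow> even e"
    proof
      assume "d dvd m"
      then obtain c where "m = d * c" by blast
      with e n \<open>d > 0\<close> have "e = 2 * c" by simp
      then show "even e" by simp
    next
      assume "even e"
      then obtain c where "e = 2 * c" by blast
      with e n have "m = d * c" by simp
      then show "d dvd m" by simp
    qed
    with e \<open>d > 0\<close> \<open>e > 0\<close> show "(-1) ^ (n div d - 1) * root_sum2 d =
        root_sum2 d - (if d dvd m then 2 * root_sum2 d else 0)"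
      by auto
  qed
  also have "\<dots> = (\<Sum>d | d dvd n. root_sum2 d) - 2 * (\<Sum>d | d dvd m. root_sum2 d)"
  proof -
    have "(\<Sum>d | d dvd n. if d dvd m then 2 * root_sum2 d else 0) = (\<Sum>d | d dvd m. 2 * root_sum2 d)"
      using fin sub by (intro sum.mono_neutral_cong_right) auto
    then show ?thesis by (simp add: sum_subtractf sum_distrib_left)
  qed
  also have "\<dots> = 0"
  proof -
    \<comment> \<open>\<open>n = 2 * m\<close> is a power of two exactly if \<open>m\<close> is, so
      the difference is \<open>n - 2 * m = 0\<close> or \<open>0 - 0\<close>.\<close>
    have "multiplicity 2 n = Suc (multiplicity 2 m)"
      using m by (simp add: n multiplicity_times_same)
    then have "n = 2 ^ multiplicity 2 n \<longleftrightarrow> m = 2 ^ multiplicity 2 m" by (simp add: n)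
    then show ?thesis
      unfolding sum_root_sum2_divisors[OF assms] sum_root_sum2_divisors[OF m] by (simp add: n)
  qed
  finally show ?thesis using True by auto
qed

text \<open>\<open>root_sum 1 d\<close> is the Moebius function of \<open>d\<close>; only its
  divisor sums enter below.\<close>

lemma Lie_formula:
  assumes "n \<ge> 1"
  shows "of_nat n * Lie n = (\<Sum>d | d dvd n. const (root_sum 1 d) * psym d ^ (n div d))"
proof -
  have "exp (2 * of_real pi * \<i> / of_nat n) = root_unity 1 n" by (simp add: root_unity_def)
  then have "of_nat n * Lie n =
      (\<Sum>k<n. const (root_unity 1 n ^ k) * psym (n div gcd k n) ^ gcd k n)"
    unfolding Lie_def by (simp only: frob_char_cyclic[OF assms])
  \<comment> \<open>The exponent now depends on \<open>k\<close> only through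
    \<open>n div gcd k n\<close>, as \<open>sum_root_sum\<close> requires.\<close>
  also have "\<dots> = (\<Sum>k<n. const (root_unity 1 n ^ k) *
      psym (n div gcd k n) ^ (n div (n div gcd k n)))"
    using assms by (intro sum.cong) (auto simp: div_div_eq_right)
  also have "\<dots> = (\<Sum>d | d dvd n. const (root_sum 1 d) * psym d ^ (n div d))"
    by (rule sum_root_sum[OF assms, of 1 "\<lambda>d. psym d ^ (n div d)"])
  finally show ?thesis .
qed

lemma Lie2_formula:
  assumes "n \<ge> 1"
  shows "of_nat n * Lie2 n = (\<Sum>d | d dvd n. const (root_sum2 d) * psym d ^ (n div d))"
proof -
  let ?q = "2 ^ multiplicity 2 n"
  have "exp (2 * of_real pi * \<i> / of_nat n * 2 ^ multiplicity (2 :: nat) n) = root_unity ?q n"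
    by (simp add: root_unity_def)
  then have "of_nat n * Lie2 n =
      (\<Sum>k<n. const (root_unity ?q n ^ k) * psym (n div gcd k n) ^ gcd k n)"
    unfolding Lie2_def by (simp only: frob_char_cyclic[OF assms])
  also have "\<dots> = (\<Sum>k<n. const (root_unity ?q n ^ k) *
      psym (n div gcd k n) ^ (n div (n div gcd k n)))"
    using assms by (intro sum.cong) (auto simp: div_div_eq_right)
  also have "\<dots> = (\<Sum>d | d dvd n. const (root_sum ?q d) * psym d ^ (n div d))"
    by (rule sum_root_sum[OF assms, of ?q "\<lambda>d. psym d ^ (n div d)"])
  also have "\<dots> = (\<Sum>d | d dvd n. const (root_sum2 d) * psym d ^ (n div d))"
  proof (rule sum.cong[OF refl])
    fix d assume "d \<in> {d. d dvd n}"
    then have "d dvd n" by simp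
    moreover from this have "d \<ge> 1" using assms by (auto simp: Suc_le_eq intro: dvd_pos_nat)
    ultimately have "root_sum ?q d = root_sum2 d"
      using multiplicity_mono[OF _ assms] by (intro root_sum_power_2) auto
    then show "const (root_sum ?q d) * psym d ^ (n div d) = const (root_sum2 d) * psym d ^ (n div d)"
      by simp
  qed
  finally show ?thesis .
qed

section \<open>Series of Lie type\<close>

text \<open>Being related to itself expresses that \<open>f\<close> is a polynomial in the power
  sums, where \<open>omega\<close> is meaningful.\<close>

lemma divisor_formula:
  assumes m: "m \<ge> 1" and f: "of_nat m * f = (\<Sum>d | d dvd m. const (R d) * psym d ^ (m div d))"
  shows "homogeneous m f" "alg_rel psym psym f f"
proof -
  have f': "f = const (1 / of_nat m) * (\<Sum>d | d dvd m. const (R d) * psym d ^ (m div d))"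
    using inverse_nat_mult_pser[of m f] m f by simp
  have const: "homogeneous m (const c * g)" if "homogeneous m g" for c g
    using that by (auto simp: homogeneous_def)
  have "homogeneous m (psym d ^ (m div d))" if "d dvd m" for d
    using homogeneous_power[OF homogeneous_sym(3)[of d], of "m div d"] that by simp
  then show "homogeneous m f"
    unfolding f' by (intro const homogeneous_sum) simp
  show "alg_rel psym psym f f"
    unfolding f' using m
    by (intro alg_rel_mult alg_rel_const alg_rel_sum alg_rel_power alg_rel_gen)
      (auto simp: Suc_le_eq intro: dvd_pos_nat)
qed

lemma deg_part_formal_sum_ge2:
  assumes "\<And>m. m \<ge> 2 \<Longrightarrow> homogeneous m (F m)"
  shows "deg_part m (formal_sum {2..} F) = (if m \<ge> 2 then F m else 0)"
proof (rule pser_eqI)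
  fix M
  have "coeff (formal_sum {2..} F) M = (if size M \<ge> 2 then coeff (F (size M)) M else 0)"
  proof -
    have "coeff (formal_sum {2..} F) M = (\<Sum>i \<in> {size M} \<inter> {2..}. coeff (F i) M)"
      unfolding coeff_formal_sum
      by (rule sum.mono_neutral_left) (use assms in \<open>auto simp: homogeneous_def\<close>)
    also have "{size M} \<inter> {2..} = (if size M \<ge> 2 then {size M} else {})" by auto
    finally show ?thesis by simp
  qed
  then show "coeff (deg_part m (formal_sum {2..} F)) M = coeff (if m \<ge> 2 then F m else 0) M"
    using assms[of m] by (auto simp: coeff_deg_part homogeneous_def)
qed

text \<open>Put L = k d in the double sum over \<open>k\<close> dividing \<open>N\<close> and
  \<open>d\<close> dividing N/k. It becomes a sum over L dividing \<open>N\<close> of p_L^(N/L)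
  times the signed divisor sum of \<open>R\<close> at L, because k = L/d. By the second hypothesis
  only L = 1 survives.\<close>

lemma lie_like_formal_sum:
  assumes F: "\<And>m. m \<ge> 1 \<Longrightarrow> of_nat m * F m = (\<Sum>d | d dvd m. const (R d) * psym d ^ (m div d))"
    and R: "\<And>n. n \<ge> 1 \<Longrightarrow> (\<Sum>d | d dvd n. (-1) ^ (t * (n div d - 1)) * R d) = (if n = 1 then 1 else 0)"
  shows "lie_like t (formal_sum {2..} F)"
proof -
  define x where "x = formal_sum {2..} F"
  note hom = divisor_formula(1)[OF _ F]
  have deg: "deg_part m x = (if m \<ge> 2 then F m else 0)" for m
    unfolding x_def by (rule deg_part_formal_sum_ge2) (auto intro: hom)
  \<comment> \<open>This makes \<open>F 1\<close> exactly the linear term that \<open>x\<close>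
    lacks.\<close>
  have "R 1 = 1" using R[of 1] by simp
  then have "F 1 = psym 1" using F[of 1] by simp
  then have deg1: "deg_part m (x + psym 1) = F m" if "m \<ge> 1" for m
    using that by (cases "m = 1") (auto simp: deg_part_add deg homogeneous_deg_part[OF homogeneous_sym(3)])
  have "vanish_below 1 x"
  proof -
    have "coeff x {#} = coeff (deg_part 0 x) {#}" by (simp add: coeff_deg_part)
    then show ?thesis by (simp add: vanish_below_def deg)
  qed
  moreover have "(\<Sum>k | k dvd N. (-1) ^ (t * (k - 1)) *
      power_subst k (of_nat (N div k) * deg_part (N div k) (x + psym 1))) = psym 1 ^ N"
    if N: "N \<ge> 1" for N
  proof -
    have pos: "d \<ge> 1" "N div d \<ge> 1" if "d dvd N" for d
      using that N by (auto simp: Suc_le_eq intro: dvd_pos_nat)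
    have fin: "finite {d. d dvd n}" if "n \<ge> 1" for n :: nat using that by auto
    define T where "T = (\<lambda>L d. const ((-1) ^ (t * (L div d - 1)) * R d) * psym L ^ (N div L))"
    have "(-1) ^ (t * (k - 1)) * power_subst k (of_nat (N div k) * deg_part (N div k) (x + psym 1)) =
        (\<Sum>d | d dvd N div k. T (k * d) d)" if k: "k dvd N" for k
    proof -
      have sign: "const ((-1) ^ i) = (-1) ^ i" for i
        by (induction i) (simp_all add: const_uminus)
      have "power_subst k (of_nat (N div k) * deg_part (N div k) (x + psym 1)) =
          power_subst k (\<Sum>d | d dvd N div k. const (R d) * psym d ^ ((N div k) div d))"
        unfolding deg1[OF pos(2)[OF k]] F[OF pos(2)[OF k]] ..
      also have "\<dots> = (\<Sum>d | d dvd N div k. const (R d) * psym (k * d) ^ (N div (k * d)))"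
        using pos(1)[OF k]
        by (simp add: power_subst_sum power_subst_const_mult power_subst_power power_subst_psym
            div_mult2_eq)
      finally have eq: "power_subst k (of_nat (N div k) * deg_part (N div k) (x + psym 1)) = \<dots>" .
      show ?thesis
        unfolding eq sum_distrib_left
      proof (rule sum.cong[OF refl])
        fix d assume "d \<in> {d. d dvd N div k}"
        then have "d > 0" using pos(2)[OF k] by (auto simp: Suc_le_eq intro: dvd_pos_nat)
        then have "k * d div d = k" by simp
        then show "(-1) ^ (t * (k - 1)) * (const (R d) * psym (k * d) ^ (N div (k * d))) = T (k * d) d"
          by (simp add: T_def const_mult sign mult.assoc)
      qed
    qed
    then have "(\<Sum>k | k dvd N. (-1) ^ (t * (k - 1)) *
        power_subst k (of_nat (N div k) * deg_part (N div k) (x + psym 1))) =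
        (\<Sum>k | k dvd N. \<Sum>d | d dvd N div k. T (k * d) d)"
      by (intro sum.cong) auto
    also have "\<dots> = (\<Sum>(k, d) \<in> (SIGMA k : {k. k dvd N}. {d. d dvd N div k}). T (k * d) d)"
      using fin pos(2) N by (subst sum.Sigma) auto
    also have "\<dots> = (\<Sum>(L, d) \<in> (SIGMA L : {L. L dvd N}. {d. d dvd L}). T L d)"
    proof (rule sum.reindex_bij_witness[where i = "\<lambda>(L, d). (L div d, d)" and j = "\<lambda>(k, d). (k * d, d)"])
      fix y assume "y \<in> (SIGMA k : {k. k dvd N}. {d. d dvd N div k})"
      then obtain k d where y: "y = (k, d)" "k dvd N" "d dvd N div k" by auto
      then have "k > 0" "d > 0"
        using pos by (auto simp: Suc_le_eq intro: dvd_pos_nat)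
      with y show "(case case y of (k, d) \<Rightarrow> (k * d, d) of (L, d) \<Rightarrow> (L div d, d)) = y"
        "(case y of (k, d) \<Rightarrow> (k * d, d)) \<in> (SIGMA L : {L. L dvd N}. {d. d dvd L})"
        by (auto simp: dvd_div_iff_mult mult.commute)
    next
      fix y assume "y \<in> (SIGMA L : {L. L dvd N}. {d. d dvd L})"
      then obtain L d where y: "y = (L, d)" "L dvd N" "d dvd L" by auto
      then have "L > 0" "d > 0" using pos by (auto simp: Suc_le_eq intro: dvd_pos_nat)
      from y obtain c where L: "L = d * c" by blast
      with \<open>L > 0\<close> \<open>d > 0\<close> have "L div d = c" "c > 0" by auto
      with y L show "(case case y of (L, d) \<Rightarrow> (L div d, d) of (k, d) \<Rightarrow> (k * d, d)) = y"
        "(case y of (L, d) \<Rightarrow> (L div d, d)) \<in> (SIGMA k : {k. k dvd N}. {d. d dvd N div k})"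
        by (auto simp: dvd_div_iff_mult mult.commute dest: dvd_mult_right)
    qed auto
    also have "\<dots> = (\<Sum>L | L dvd N. \<Sum>d | d dvd L. T L d)"
      using fin[OF N] fin[OF pos(1)] by (subst sum.Sigma) auto
    also have "\<dots> = (\<Sum>L | L dvd N. if L = 1 then psym 1 ^ N else 0)"
    proof (rule sum.cong[OF refl])
      fix L assume "L \<in> {L. L dvd N}"
      then have "L \<ge> 1" using pos(1) by simp
      have "(\<Sum>d | d dvd L. T L d) = const (if L = 1 then 1 else 0) * psym L ^ (N div L)"
        unfolding R[OF \<open>L \<ge> 1\<close>, symmetric] T_def const_sum sum_distrib_right ..
      then show "(\<Sum>d | d dvd L. T L d) = (if L = 1 then psym 1 ^ N else 0)" by auto
    qed
    also have "\<dots> = psym 1 ^ N" using fin[OF N] by simp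
    finally show ?thesis .
  qed
  ultimately show ?thesis unfolding lie_like_def x_def by blast
qed

lemma lie_like_Lie: "lie_like 0 Lie_ge2"
  unfolding Lie_ge2_def
proof (rule lie_like_formal_sum[OF Lie_formula])
  fix n :: nat assume "n \<ge> 1"
  then show "(\<Sum>d | d dvd n. (-1) ^ (0 * (n div d - 1)) * root_sum 1 d) = (if n = 1 then 1 else 0)"
    using sum_root_sum_divisors[of n 1] by simp
qed

lemma lie_like_Lie2: "lie_like 1 Lie2_ge2"
  unfolding Lie2_ge2_def
proof (rule lie_like_formal_sum[OF Lie2_formula])
  fix n :: nat assume "n \<ge> 1"
  then show "(\<Sum>d | d dvd n. (-1) ^ (1 * (n div d - 1)) * root_sum2 d) = (if n = 1 then 1 else 0)"
    using signed_sum_root_sum2_divisors[of n] by simp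
qed

section \<open>The hook Schur function\<close>

lemma young_diagram_hook:
  assumes "n \<ge> 2"
  shows "young_diagram (2 # replicate (n - 2) 1) = insert (0, 1) ((\<lambda>i. (i, 0)) ` {..<n - 1})"
proof -
  have "(i, j) \<in> young_diagram (2 # replicate (n - 2) 1) \<longleftrightarrow> (i = 0 \<and> j = 1) \<or> (i < n - 1 \<and> j = 0)" for i j
    using assms by (cases i) (auto simp: young_diagram_def)
  then show ?thesis by auto
qed

lemma image_mset_hook:
  "image_mset T (mset_set (insert (0, 1) ((\<lambda>i. (i, 0)) ` {..<m}))) =
    add_mset (T (0, 1 :: nat)) (mset (map (\<lambda>i. T (i, 0)) [0..<m]))" for T :: "nat \<times> nat \<Rightarrow> nat"
proof -
  have "mset_set ((\<lambda>i. (i, 0 :: nat)) ` {..<m}) = image_mset (\<lambda>i. (i, 0)) (mset_set {..<m})"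
    by (rule image_mset_mset_set[symmetric]) (auto simp: inj_on_def)
  moreover have "mset_set {..<m} = mset [0..<m]"
    by (metis atLeast0LessThan atLeast_upt mset_set_upto_eq_mset_upto)
  ultimately show ?thesis
    by (simp add: multiset.map_comp comp_def image_iff)
qed

lemma distinct_iff_count_le_1: "distinct xs \<longleftrightarrow> (\<forall>i. count (mset xs) i \<le> 1)"
proof
  assume "distinct xs"
  then show "\<forall>i. count (mset xs) i \<le> 1"
    by (simp add: distinct_count_atmost_1)
next
  assume le: "\<forall>i. count (mset xs) i \<le> 1"
  have "count (mset xs) i = (if i \<in> set xs then 1 else 0)" for i
    using le[rule_format, of i] count_greater_zero_iff[of "mset xs" i]
    by (auto simp: le_Suc_eq simp del: count_greater_zero_iff count_mset_gt_0)
  then show "distinct xs" by (simp add: distinct_count_atmost_1)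
qed

text \<open>A tableau of this shape is determined by its content and the entry \<open>a\<close> outside the first
  column.\<close>

lemma card_ssyt_hook:
  assumes n: "n \<ge> 2"
  defines "\<mu> \<equiv> 2 # replicate (n - 2) 1"
  shows "card {T \<in> ssyt \<mu>. image_mset T (mset_set (young_diagram \<mu>)) = M} =
    card {a. a \<in># M \<and> size M = n \<and> (\<forall>i. count (M - {#a#}) i \<le> 1) \<and> (\<exists>b. b \<in># M - {#a#} \<and> b \<le> a)}"
    (is "card ?S = card ?A")
proof -
  define m where "m = n - 1"
  have m: "m \<ge> 1" "n = Suc m" using n by (auto simp: m_def)
  define D where "D = insert (0, 1) ((\<lambda>i. (i, 0 :: nat)) ` {..<m})"
  have D: "young_diagram \<mu> = D" unfolding \<mu>_def D_def m_def by (rule young_diagram_hook[OF n])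
  have mem_D: "(i, j) \<in> D \<longleftrightarrow> (i = 0 \<and> j = 1) \<or> (i < m \<and> j = 0)" for i j
    by (auto simp: D_def)
  define L where "L = (\<lambda>T :: nat \<times> nat \<Rightarrow> nat. map (\<lambda>i. T (i, 0)) [0..<m])"
  \<comment> \<open>The top row is the only one with two boxes; the other condition is strict
    increase down the first column.\<close>
  have ssyt: "T \<in> ssyt \<mu> \<longleftrightarrow> T \<in> extensional D \<and> T (0, 0) \<le> T (0, 1) \<and> sorted_wrt (<) (L T)" for T
  proof -
    have "(\<forall>i j. (i, Suc j) \<in> D \<longrightarrow> T (i, j) \<le> T (i, Suc j)) \<longleftrightarrow> T (0, 0) \<le> T (0, 1)"
      by (auto simp: mem_D)
    moreover have "(\<forall>i j. (Suc i, j) \<in> D \<longrightarrow> T (i, j) < T (Suc i, j)) \<longleftrightarrow> sorted_wrt (<) (L T)"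
      by (auto simp: mem_D L_def sorted_wrt_iff_nth_Suc_transp)
    ultimately show ?thesis by (simp add: ssyt_def D)
  qed
  have content: "image_mset T (mset_set (young_diagram \<mu>)) = add_mset (T (0, 1)) (mset (L T))" for T
    unfolding D D_def L_def by (rule image_mset_hook)
  define col where "col = (\<lambda>a. sorted_list_of_multiset (M - {#a#}))"
  \<comment> \<open>The inverse map: \<open>a\<close> goes into the box \<open>(0, 1)\<close>, the
    rest of the content is sorted down the first column.\<close>
  define F where "F = (\<lambda>a. \<lambda>x \<in> D. if x = (0, 1) then a else col a ! fst x)"
  have "bij_betw (\<lambda>T. T (0, 1)) ?S ?A"
  proof (rule bij_betw_byWitness[where f' = F])
    have col: "col (T (0, 1)) = L T" and M: "M = add_mset (T (0, 1)) (mset (L T))" if "T \<in> ?S" for T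
    proof -
      show M: "M = add_mset (T (0, 1)) (mset (L T))" using that by (simp add: content)
      have "sorted (L T)" using that by (simp add: ssyt strict_sorted_iff)
      then show "col (T (0, 1)) = L T"
        by (simp add: col_def M sorted_sort_id)
    qed
    show "\<forall>T\<in>?S. F (T (0, 1)) = T"
    proof
      fix T assume T: "T \<in> ?S"
      show "F (T (0, 1)) = T"
      proof
        fix x :: "nat \<times> nat"
        obtain i j where x: "x = (i, j)" by (cases x)
        have "T \<in> extensional D" using T by (simp add: ssyt)
        then show "F (T (0, 1)) x = T x"
          using col[OF T] by (cases "x \<in> D") (auto simp: F_def x mem_D L_def extensional_def)
      qed
    qed
    show "\<forall>a\<in>?A. F a (0, 1) = a"
      by (simp add: F_def mem_D)
    show "(\<lambda>T. T (0, 1)) ` ?S \<subseteq> ?A"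
    proof safe
      fix T assume "T \<in> ssyt \<mu>" "M = image_mset T (mset_set (young_diagram \<mu>))"
      then have T: "T \<in> ?S" by simp
      note M = M[OF T]
      show "T (0, 1) \<in># image_mset T (mset_set (young_diagram \<mu>))"
        by (simp add: content)
      show "size (image_mset T (mset_set (young_diagram \<mu>))) = n"
        unfolding content by (simp add: L_def m)
      have "distinct (L T)" using T by (simp add: ssyt strict_sorted_iff)
      then show "count (image_mset T (mset_set (young_diagram \<mu>)) - {#T (0, 1)#}) i \<le> 1" for i
        unfolding content by (simp add: distinct_iff_count_le_1)
      have "T (0, 0) \<in> set (L T)" using m by (auto simp: L_def)
      moreover have "T (0, 0) \<le> T (0, 1)" using T by (simp add: ssyt)
      ultimately show "\<exists>b. b \<in># image_mset T (mset_set (young_diagram \<mu>)) - {#T (0, 1)#} \<and> b \<le> T (0, 1)"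
        unfolding content by auto
    qed
    show "F ` ?A \<subseteq> ?S"
    proof
      fix T assume "T \<in> F ` ?A"
      then obtain a b where T: "T = F a" and a: "a \<in># M" "size M = n"
        "\<forall>i. count (M - {#a#}) i \<le> 1" and b: "b \<in># M - {#a#}" "b \<le> a" by blast
      have mset_col: "mset (col a) = M - {#a#}" by (simp add: col_def)
      have len: "length (col a) = m"
        using a m by (metis mset_col size_Diff_singleton size_mset diff_Suc_1)
      have L: "L (F a) = col a"
        by (rule nth_equalityI) (auto simp: L_def len F_def mem_D)
      have "distinct (col a)" unfolding distinct_iff_count_le_1 mset_col by (rule a(3))
      moreover have sorted: "sorted (col a)" by (simp add: col_def)
      ultimately have "sorted_wrt (<) (L (F a))" by (simp add: L strict_sorted_iff)
      moreover have "F a (0, 0) \<le> F a (0, 1)"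
      proof -
        \<comment> \<open>Some column entry is at most \<open>a\<close>, hence so is the top one,
          the smallest.\<close>
        have "b \<in> set (col a)" using b(1) by (metis mset_col set_mset_mset)
        then obtain i where "i < m" "b = col a ! i" by (auto simp: in_set_conv_nth len)
        then have "col a ! 0 \<le> b" using sorted by (auto simp: sorted_nth_mono len)
        then show ?thesis using b(2) m by (simp add: F_def mem_D)
      qed
      moreover have "F a \<in> extensional D" by (simp add: F_def)
      moreover have "image_mset (F a) (mset_set (young_diagram \<mu>)) = M"
        unfolding content L mset_col using a(1) by (simp add: F_def mem_D)
      ultimately show "T \<in> ?S" by (simp add: T ssyt)
    qed
  qed
  then show ?thesis by (rule bij_betw_same_card)
qed

lemma coeff_psym_1_mult:
  "coeff (psym 1 * f) M = (\<Sum>a\<in>set_mset M. coeff f (M - {#a#}))"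
proof -
  have "coeff (psym 1 * f) M = (\<Sum>A \<in> (\<lambda>a. {#a#}) ` set_mset M. coeff (psym 1) A * coeff f (M - A))"
    unfolding coeff_mult
    by (rule sum.mono_neutral_right[OF finite_submsets]) (auto simp: coeff_psym)
  also have "\<dots> = (\<Sum>a\<in>set_mset M. coeff f (M - {#a#}))"
    by (subst sum.reindex) (auto simp: inj_on_def coeff_psym)
  finally show ?thesis .
qed

text \<open>Pieri's rule for p_1 e_(n-1), on coefficients. \<open>A\<close> holds the entries whose
  removal leaves a strict column, \<open>B\<close> those smaller than all of that column, which
  therefore extend it to a longer strict column. For monomials of degree \<open>n\<close>,
  \<open>B\<close> is the minimum alone if \<open>M\<close> is squarefree and empty otherwise, so it
  accounts for e_n.\<close>

lemma schur_hook:
  assumes n: "n \<ge> 2"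
  shows "schur (2 # replicate (n - 2) 1) = psym 1 * esym (n - 1) - esym n"
proof (rule pser_eqI)
  fix M :: "nat multiset"
  define A where "A = {a. a \<in># M \<and> (\<forall>i. count (M - {#a#}) i \<le> 1)}"
  define B where "B = {a \<in> A. \<forall>b. b \<in># M - {#a#} \<longrightarrow> a < b}"
  have fin: "finite A" "B \<subseteq> A" by (auto simp: A_def B_def)
  have coeff: "coeff (schur (2 # replicate (n - 2) 1)) M = of_nat (card {a \<in> A - B. size M = n})"
  proof -
    have "{a. a \<in># M \<and> size M = n \<and> (\<forall>i. count (M - {#a#}) i \<le> 1) \<and> (\<exists>b. b \<in># M - {#a#} \<and> b \<le> a)} =
        {a \<in> A - B. size M = n}"
      by (auto simp: A_def B_def not_less)
    then show ?thesis using card_ssyt_hook[OF n, of M] by (simp add: schur.rep_eq)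
  qed
  have pe: "coeff (psym 1 * esym (n - 1)) M = (if size M = n then of_nat (card A) else 0)"
  proof -
    have "coeff (psym 1 * esym (n - 1)) M =
        (\<Sum>a\<in>set_mset M. if a \<in> A \<and> size M = n then 1 else 0)"
      unfolding coeff_psym_1_mult
    proof (rule sum.cong[OF refl])
      fix a assume a: "a \<in># M"
      then have "size (M - {#a#}) = n - 1 \<longleftrightarrow> size M = n"
        using n by (cases "size M") (auto simp: size_Diff_singleton)
      with a show "coeff (esym (n - 1)) (M - {#a#}) = (if a \<in> A \<and> size M = n then 1 else 0)"
        by (auto simp: coeff_esym A_def)
    qed
    also have "\<dots> = (\<Sum>a\<in>A. if size M = n then 1 else 0)"
      by (rule sum.mono_neutral_cong_right) (auto simp: A_def)
    finally show ?thesis by simp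
  qed
  show "coeff (schur (2 # replicate (n - 2) 1)) M = coeff (psym 1 * esym (n - 1) - esym n) M"
  proof (cases "size M = n")
    case False
    then show ?thesis using coeff pe by (simp add: coeff_esym)
  next
    case True
    have "card B = (if \<forall>i. count M i \<le> 1 then 1 else 0)"
    proof (cases "\<forall>i. count M i \<le> 1")
      case sqf: True
      have "M \<noteq> {#}" using True n by auto
      define a where "a = Min (set_mset M)"
      have a: "a \<in># M" "\<And>b. b \<in># M \<Longrightarrow> a \<le> b"
        using \<open>M \<noteq> {#}\<close> by (auto simp: a_def)
      have not: "c \<notin># M - {#c#}" for c
        using sqf[rule_format, of c] by (auto simp: not_in_iff)
      have "B = {a}"
      proof (intro equalityI subsetI)
        fix c assume c: "c \<in> B"
        show "c \<in> {a}"
        proof (rule ccontr)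
          assume "c \<notin> {a}"
          then have "a \<in># M - {#c#}" using a(1) by (simp add: in_diff_count)
          with c have "c < a" by (auto simp: B_def)
          moreover have "c \<in># M" using c by (simp add: B_def A_def)
          ultimately show False using a(2)[of c] by simp
        qed
      next
        fix c assume "c \<in> {a}"
        have "a < b" if "b \<in># M - {#a#}" for b
          using that not[of a] a(2)[of b] by (metis in_diffD le_neq_implies_less)
        moreover have "count (M - {#a#}) i \<le> 1" for i
          using sqf[rule_format, of i] by simp
        ultimately show "c \<in> B" using a(1) \<open>c \<in> {a}\<close> by (auto simp: B_def A_def)
      qed
      with sqf show ?thesis by simp
    next
      case False
      have "c \<notin> B" for c
      proof
        assume c: "c \<in> B"
        have "count M i \<le> 1" for i
        proof (cases "i = c")
          case True
          have "c \<notin># M - {#c#}" using c by (auto simp: B_def)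
          then show ?thesis using True by (simp add: not_in_iff)
        next
          case False
          moreover have "count (M - {#c#}) i \<le> 1" using c by (simp add: B_def A_def)
          ultimately show ?thesis by simp
        qed
        with \<open>\<not> (\<forall>i. count M i \<le> 1)\<close> show False by blast
      qed
      then have "B = {}" by blast
      with False show ?thesis by simp
    qed
    moreover have "card (A - B) = card A - card B" "card B \<le> card A"
      using fin by (auto simp: card_Diff_subset card_mono finite_subset)
    ultimately have "of_nat (card (A - B)) = of_nat (card A) - coeff (esym n) M"
      using True by (auto simp: coeff_esym of_nat_diff)
    moreover have "{a \<in> A - B. size M = n} = A - B" using True by auto
    ultimately show ?thesis using coeff pe True by simp
  qed
qed

section \<open>The involution\<close>

lemma alg_rel_power_subst:
  assumes "alg_rel psym psym f g" "k \<ge> 1"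
  shows "alg_rel psym psym (power_subst k f) (power_subst k f)"
  using assms(1)
proof induction
  case (alg_rel_const c)
  then show ?case
    unfolding power_subst_const[OF assms(2)] by (rule alg_rel.alg_rel_const)
next
  case (alg_rel_gen n)
  then show ?case
    unfolding power_subst_psym[OF assms(2)] using assms(2) by (intro alg_rel.alg_rel_gen) simp
next
  case (alg_rel_add f g f' g')
  then show ?case unfolding power_subst_add by (intro alg_rel.alg_rel_add)
next
  case (alg_rel_mult f g f' g')
  then show ?case unfolding power_subst_mult[OF assms(2)] by (intro alg_rel.alg_rel_mult)
qed

text \<open>Plethysm with an infinite series may leave the algebra generated by the power sums, but
  each homogeneous component stays in it, and \<open>omega\<close> is applied only to
  components.\<close>

lemma alg_rel_deg_part:
  assumes "alg_rel psym (\<lambda>k. power_subst k x) f g"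
    and x: "\<And>m. alg_rel psym psym (deg_part m x) (deg_part m x)"
  shows "alg_rel psym psym (deg_part n g) (deg_part n g)"
  using assms(1)
proof (induction arbitrary: n)
  case (alg_rel_const c)
  have "deg_part n (const c) = const (if n = 0 then c else 0)"
    by (auto intro!: pser_eqI simp: coeff_deg_part coeff_const)
  then show ?case by (simp only: alg_rel.alg_rel_const)
next
  case (alg_rel_gen k)
  then show ?case
    using alg_rel_power_subst[OF x, of k "n div k"] by (simp add: deg_part_power_subst alg_rel_0)
next
  case (alg_rel_add f g f' g')
  then show ?case unfolding deg_part_add by (intro alg_rel.alg_rel_add)
next
  case (alg_rel_mult f g f' g')
  then show ?case unfolding deg_part_mult by (intro alg_rel_sum alg_rel.alg_rel_mult)
qed

text \<open>a_r[x] has no component below degree \<open>r\<close>, so the summands with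
  \<open>r > n\<close> vanish. \<open>\<phi>\<close> stands for \<open>omega\<close> or the
  identity.\<close>

lemma formal_sum_deg_part_plethysm:
  assumes a: "newton t psym a" and x: "vanish_below 1 x"
    and \<phi>: "\<phi> 0 = 0"
  shows "formal_sum {1..} (\<lambda>r. (-1) ^ e r * \<phi> (deg_part n (plethysm (a r) x))) =
    (\<Sum>r=1..n. (-1) ^ e r * \<phi> (deg_part n (plethysm (a r) x)))"
proof (rule formal_sum_eq_sum)
  fix r assume "r \<in> {1..}" "r \<notin> {1..n}"
  then have "n < r" by auto
  then have "deg_part n (plethysm (a r) x) = 0"
    using vanish_below_plethysm[OF a x, of r]
    by (auto intro!: pser_eqI simp: coeff_deg_part vanish_below_def)
  then show "(-1) ^ e r * \<phi> (deg_part n (plethysm (a r) x)) = 0" by (simp add: \<phi>)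
qed auto

text \<open>Additivity of \<open>omega\<close> enters through \<open>alg_rel\<close>: each summand
  is related to its image, hence the sum to the sum of the images, and uniqueness identifies the
  latter with \<open>g\<close>.\<close>

lemma formal_sum_omega_plethysm:
  assumes a: "newton t psym a" and x: "vanish_below 1 x"
    and sym: "\<And>m. alg_rel psym psym (deg_part m x) (deg_part m x)"
    and g: "alg_rel hsym esym (\<Sum>r=1..n. (-1) ^ e r * deg_part n (plethysm (a r) x)) g"
  shows "formal_sum {1..} (\<lambda>r. (-1) ^ e r * omega (deg_part n (plethysm (a r) x))) = g"
proof -
  have omega_0: "omega 0 = 0" by (intro omega_eqI alg_rel_0)
  have rel: "alg_rel hsym esym (deg_part n (plethysm (a r) x)) (omega (deg_part n (plethysm (a r) x)))" for r
  proof -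
    have "alg_rel psym psym (deg_part n (plethysm (a r) x)) (deg_part n (plethysm (a r) x))"
      by (rule alg_rel_deg_part[OF newton_plethysm(2)[OF a] sym])
    then obtain g where "alg_rel hsym esym (deg_part n (plethysm (a r) x)) g"
      using alg_rel_hsym_of_psym by blast
    then show ?thesis using omega_eqI by blast
  qed
  have "alg_rel hsym esym (\<Sum>r=1..n. (-1) ^ e r * deg_part n (plethysm (a r) x))
      (\<Sum>r=1..n. (-1) ^ e r * omega (deg_part n (plethysm (a r) x)))"
    by (intro alg_rel_sum alg_rel_signed rel)
  then have "(\<Sum>r=1..n. (-1) ^ e r * omega (deg_part n (plethysm (a r) x))) = g"
    unfolding omega_eqI[OF g, symmetric] by (rule omega_eqI[symmetric])
  then show ?thesis
    unfolding formal_sum_deg_part_plethysm[OF a x, of omega, OF omega_0] .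
qed

lemma alg_rel_deg_part_Lie_ge2: "alg_rel psym psym (deg_part m Lie_ge2) (deg_part m Lie_ge2)"
proof -
  have "homogeneous k (Lie k)" if "k \<ge> 2" for k
    using that by (intro divisor_formula(1)[OF _ Lie_formula]) auto
  then have "deg_part m Lie_ge2 = (if m \<ge> 2 then Lie m else 0)"
    unfolding Lie_ge2_def by (rule deg_part_formal_sum_ge2)
  then show ?thesis
    using divisor_formula(2)[OF _ Lie_formula, of m] by (simp add: alg_rel_0)
qed

theorem theorem2p18:
  fixes n :: nat
  assumes "n \<ge> 2"
  shows
    "(formal_sum {1..} (\<lambda>r. omega (deg_part n (plethysm (hsym r) Lie_ge2)))
        = (\<Sum>k=0..n. (-1) ^ k * psym 1 ^ (n - k) * hsym k)
      \<and> (\<Sum>k=0..n. (-1) ^ k * psym 1 ^ (n - k) * hsym k)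
        = formal_sum {1..} (\<lambda>r. deg_part n (plethysm (esym r) Lie2_ge2)))
    \<and> (formal_sum {1..} (\<lambda>r. (-1) ^ (r - 1) * omega (deg_part n (plethysm (esym r) Lie_ge2)))
        = schur (2 # replicate (n - 2) 1)
      \<and> schur (2 # replicate (n - 2) 1)
        = formal_sum {1..} (\<lambda>r. (-1) ^ (r - 1) * deg_part n (plethysm (hsym r) Lie2_ge2)))"
proof -
  have n: "n \<ge> 1" using assms by simp
  note hom = homogeneous_sym(1,2)
  note dual_eh = dual_esym_hsym
  note dual_he = dual_sym[OF dual_eh]
  \<comment> \<open>Here the pair is (h, e), giving sums in e_k and p_1 h_(n-1) - h_n, which the
    involution turns into the stated forms. For \<open>Lie2_ge2\<close> the pair is (e, h) and these
    forms appear at once.\<close>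
  note Lie = plethysm_lie_like[OF newton_hsym newton_esym dual_he hom lie_like_Lie n]
  note Lie2 = plethysm_lie_like[OF newton_esym newton_hsym dual_eh hom(2,1) lie_like_Lie2 n]
  have van: "vanish_below 1 Lie_ge2" "vanish_below 1 Lie2_ge2"
    using lie_like_Lie lie_like_Lie2 by (auto simp: lie_like_def)
  have rel_p: "alg_rel hsym esym (psym 1) (psym 1)"
    using alg_rel_gen[of 1 hsym esym] unfolding hsym_1 esym_1 by simp
  have rel_e: "alg_rel hsym esym (esym k) (hsym k)" for k
    by (rule alg_rel_dual[OF dual_he dual_eh])
  have rel_h: "alg_rel hsym esym (hsym k) (esym k)" for k
    by (cases "k = 0") (auto intro: alg_rel_1 alg_rel_gen)
  \<comment> \<open>The factor \<open>(-1) ^ 0\<close> fits the sum to the lemma with a sign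
    exponent.\<close>
  have "formal_sum {1..} (\<lambda>r. (-1) ^ 0 * omega (deg_part n (plethysm (hsym r) Lie_ge2))) =
      (\<Sum>k=0..n. (-1) ^ k * psym 1 ^ (n - k) * hsym k)"
  proof (rule formal_sum_omega_plethysm[OF newton_hsym van(1) alg_rel_deg_part_Lie_ge2])
    show "alg_rel hsym esym (\<Sum>r=1..n. (-1) ^ 0 * deg_part n (plethysm (hsym r) Lie_ge2))
        (\<Sum>k=0..n. (-1) ^ k * psym 1 ^ (n - k) * hsym k)"
      unfolding power_0 mult_1_left Lie(1) mult.assoc
      by (intro alg_rel_sum alg_rel_signed alg_rel_mult alg_rel_power rel_p rel_e)
  qed
  moreover have "formal_sum {1..} (\<lambda>r. (-1) ^ 0 * deg_part n (plethysm (esym r) Lie2_ge2)) =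
      (\<Sum>k=0..n. (-1) ^ k * psym 1 ^ (n - k) * hsym k)"
    using formal_sum_deg_part_plethysm[OF newton_esym van(2), of id "\<lambda>_. 0" n] Lie2(1) by simp
  moreover have "formal_sum {1..} (\<lambda>r. (-1) ^ (r - 1) * omega (deg_part n (plethysm (esym r) Lie_ge2))) =
      schur (2 # replicate (n - 2) 1)"
    unfolding schur_hook[OF assms]
  proof (rule formal_sum_omega_plethysm[OF newton_esym van(1) alg_rel_deg_part_Lie_ge2])
    show "alg_rel hsym esym (\<Sum>r=1..n. (-1) ^ (r - 1) * deg_part n (plethysm (esym r) Lie_ge2))
        (psym 1 * esym (n - 1) - esym n)"
      unfolding Lie(2) by (intro alg_rel_diff alg_rel_mult rel_p rel_h)
  qed
  moreover have "formal_sum {1..} (\<lambda>r. (-1) ^ (r - 1) * deg_part n (plethysm (hsym r) Lie2_ge2)) =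
      schur (2 # replicate (n - 2) 1)"
    using formal_sum_deg_part_plethysm[OF newton_hsym van(2), of id "\<lambda>r. r - 1" n] Lie2(2)
    unfolding schur_hook[OF assms] by simp
  ultimately show ?thesis by simp
qed

end
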